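(* Let $\mathcal{M} \subset \mathbb{R}^d$ be a compact and connected $k$-dimensional $C^2$ submanifold without boundary. There is a constant $C>0$ depending only on $\mathcal{M}$ such that the following holds whenever $0<\varepsilon \le 1/C$. For every finite set $\mathbf{X} = \{x_1,\dots,x_n\} \subset \mathcal{M}$ that is an $\varepsilon$-covering of $\mathcal{M}$, and every surface $\hat{\mathcal{M}} \in \mathbb{M}(k,\mathbf{X},\varepsilon)$ with reach $\rho(\hat{\mathcal{M}}) \ge \rho_{\max}/2$, $$|\mathsf{d}_{\mathcal{M}}(x,x') - \mathsf{d}_{\hat{\mathcal{M}}}(x,x')| \le C \varepsilon^2 \min\{\mathsf{d}_{\mathcal{M}}(x,x'), \mathsf{d}_{\hat{\mathcal{M}}}(x,x')\}, \qquad \forall x, x' \in \mathcal{M}\cap\hat{\mathcal{M}}.$$ In particular, the estimator $\hat d_{ij} := \mathsf{d}_{\hat{\mathcal{M}}}(x_i,x_j)$, $i,j\in[n]$, satisfies $$|\mathsf{d}_{\mathcal{M}}(x_i,x_j) - \hat d_{ij}| \le C\varepsilon^2 \min\{\mathsf{d}_{\mathcal{M}}(x_i,x_j), \hat d_{ij}\}, \qquad \forall i,j\in[n].$$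
   Context: $\|\cdot\|$ is the Euclidean norm and $[n]=\{1,\dots,n\}$. For a submanifold $\mathcal{S}\subset\mathbb{R}^d$, $\mathsf{d}_{\mathcal{S}}(x,x')$ denotes the intrinsic distance, i.e. the infimum of the lengths of curves on $\mathcal{S}$ joining $x$ and $x'$. A finite set $\mathbf{X}=\{x_1,\dots,x_n\}\subset\mathcal{S}$ is an $\varepsilon$-covering of $\mathcal{S}$ if $\max_{x\in\mathcal{S}}\min_{i}\|x-x_i\|\le\varepsilon$. The reach $\rho(\mathcal{S})$ of $\mathcal{S}$ is the infimum of the distances between a point of $\mathcal{S}$ and a point of the medial axis of $\mathcal{S}$, the latter being the set of points of $\mathbb{R}^d$ having two or more closest points on $\mathcal{S}$. $\mathbb{M}(k,\mathbf{X},\varepsilon)$ is the class of all compact connected $k$-dimensional $C^2$ submanifolds without boundary of $\mathbb{R}^d$ that contain $\mathbf{X}$ and for which $\mathbf{X}$ is an $\varepsilon$-covering (it contains $\mathcal{M}$), and $\rho_{\max}$ is the supremum of the reach over this class. Thus $\rho(\hat{\mathcal{M}})\ge\rho_{\max}/2\ge\rho(\mathcal{M})/2$. *)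

theory Defs
  imports "HOL-Analysis.Analysis"
begin

definition C2_on :: "('a::real_normed_vector \<Rightarrow> 'b::real_normed_vector) \<Rightarrow> 'a set \<Rightarrow> bool" where
  "C2_on f U \<longleftrightarrow>
     (\<exists>(f' :: 'a \<Rightarrow> 'a \<Rightarrow>\<^sub>L 'b) (f'' :: 'a \<Rightarrow> 'a \<Rightarrow>\<^sub>L ('a \<Rightarrow>\<^sub>L 'b)).
        (\<forall>x\<in>U. (f has_derivative blinfun_apply (f' x)) (at x)) \<and>
        (\<forall>x\<in>U. (f' has_derivative blinfun_apply (f'' x)) (at x)) \<and>
        continuous_on U f'')"

text \<open>
  Embedded submanifolds without boundary, by slice charts: near each of its points, the set is
  carried onto an open piece of a \<open>k\<close>-dimensional linear subspace by a \<open>C\<^sup>2\<close> diffeomorphism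
  between open subsets of the ambient space.
\<close>

definition C2_submanifold :: "nat \<Rightarrow> 'a::euclidean_space set \<Rightarrow> bool" where
  "C2_submanifold k S \<longleftrightarrow>
     (\<forall>p\<in>S. \<exists>(U :: 'a set) (V :: 'a set) (L :: 'a set) \<phi> \<psi>.
        open U \<and> p \<in> U \<and> open V \<and> subspace L \<and> dim L = k \<and>
        homeomorphism U V \<phi> \<psi> \<and> C2_on \<phi> U \<and> C2_on \<psi> V \<and>
        \<phi> ` (S \<inter> U) = L \<inter> V)"

text \<open>
  Length of a continuous curve parametrized by \<open>[0, 1]\<close>, as the supremum of the lengths of the
  inscribed polygonal lines; it is \<open>\<infinity>\<close> for curves that are not rectifiable.
\<close>

definition curve_length :: "(real \<Rightarrow> 'a::metric_space) \<Rightarrow> ereal" where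
  "curve_length \<gamma> =
     (SUP (n, t) \<in> {(n :: nat, t :: nat \<Rightarrow> real). t 0 = 0 \<and> t n = 1 \<and> mono_on {..n} t}.
        ereal (\<Sum>i<n. dist (\<gamma> (t i)) (\<gamma> (t (Suc i)))))"

text \<open>
  The infimum is taken in the extended reals, so that it is \<open>\<infinity>\<close> if the points are not joined
  by a rectifiable curve on \<open>S\<close>.
\<close>

definition intrinsic_dist :: "'a::metric_space set \<Rightarrow> 'a \<Rightarrow> 'a \<Rightarrow> ereal" where
  "intrinsic_dist S x x' =
     (INF \<gamma> \<in> {\<gamma>. path \<gamma> \<and> path_image \<gamma> \<subseteq> S \<and> pathstart \<gamma> = x \<and> pathfinish \<gamma> = x'}.
        curve_length \<gamma>)"

definition medial_axis :: "'a::metric_space set \<Rightarrow> 'a set" where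
  "medial_axis S =
     {z. \<exists>a\<in>S. \<exists>b\<in>S. a \<noteq> b \<and> (\<forall>y\<in>S. dist z a \<le> dist z y) \<and> (\<forall>y\<in>S. dist z b \<le> dist z y)}"

text \<open>The reach is \<open>\<infinity>\<close> if the medial axis is empty.\<close>

definition reach :: "'a::metric_space set \<Rightarrow> ereal" where
  "reach S = (INF x\<in>S. INF z\<in>medial_axis S. ereal (dist x z))"

text \<open>
  For \<open>X\<close> finite and nonempty and \<open>S\<close> compact and nonempty, the supremum and the infimum below
  are the maximum over \<open>S\<close> and the minimum over \<open>X\<close>.
\<close>

definition eps_covering :: "real \<Rightarrow> 'a::real_normed_vector set \<Rightarrow> 'a set \<Rightarrow> bool" where
  "eps_covering \<epsilon> X S \<longleftrightarrow>
     finite X \<and> X \<subseteq> S \<and> (SUP x\<in>S. INF y\<in>X. ereal (norm (x - y))) \<le> ereal \<epsilon>"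

definition surface_class :: "nat \<Rightarrow> 'a::euclidean_space set \<Rightarrow> real \<Rightarrow> 'a set set" where
  "surface_class k X \<epsilon> =
     {S. compact S \<and> connected S \<and> C2_submanifold k S \<and> X \<subseteq> S \<and> eps_covering \<epsilon> X S}"

definition rho_max :: "nat \<Rightarrow> 'a::euclidean_space set \<Rightarrow> real \<Rightarrow> ereal" where
  "rho_max k X \<epsilon> = (SUP S\<in>surface_class k X \<epsilon>. reach S)"

end

theory Submission
  imports Defs
begin

text \<open>
  The closest point map onto a set \<open>S\<close> of reach at least \<open>\<rho>\<close> is Lipschitz with constant
  \<open>\<rho> / (\<rho> - h)\<close> on the \<open>h\<close>-neighbourhood of \<open>S\<close> (Federer), and it fixes \<open>S\<close>. Pushing curves on one of
  the two surfaces to the other one by closest points therefore changes lengths by a factor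
  \<open>1 + O(\<epsilon>\<^sup>2)\<close> at most, once each surface lies within \<open>h = O(\<epsilon>\<^sup>2)\<close> of the other.
  The latter holds because near a common sample point each surface is a second-order perturbation of
  its tangent space there, and the tangent spaces make an angle \<open>O(\<epsilon>)\<close>: moving a distance
  \<open>4\<epsilon>\<close> from the sample point in a direction tangent to one surface leads to within \<open>2\<epsilon>\<close> of
  another sample point, which lies \<open>O(\<epsilon>\<^sup>2)\<close> close to both tangent spaces.
\<close>

section \<open>Charts and tangent spaces\<close>

text \<open>The two clauses are a quantitative second-order contact: the first keeps
  \<open>T\<close> from being too small, the second from being too large, so they stand in for a
  dimension count. The region \<open>N\<close> is separate from the scale \<open>r\<close> because
  the estimate is first obtained on a chart ball around some \<open>p\<close> and only later on
  balls around \<open>a\<close> itself.\<close>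

definition tangent_space :: "real \<Rightarrow> 'a::euclidean_space set \<Rightarrow> 'a set \<Rightarrow> 'a \<Rightarrow> 'a set \<Rightarrow> bool" where
  "tangent_space r S N a T \<longleftrightarrow> subspace T \<and>
     (\<forall>y\<in>S \<inter> N. \<exists>t\<in>T. norm (y - a - t) \<le> (norm (y - a))\<^sup>2 / r) \<and>
     (\<forall>w\<in>T. norm w < r \<longrightarrow> (\<exists>y\<in>S. norm (y - a - w) \<le> (norm w)\<^sup>2 / r))"

lemma tangent_space_mono:
  assumes "tangent_space r S N a T" "0 < r'" "r' \<le> r" "N' \<subseteq> N"
  shows "tangent_space r' S N' a T"
proof -
  have "m\<^sup>2 / r \<le> m\<^sup>2 / r'" for m :: real using assms by (simp add: frac_le)
  then show ?thesis
    using assms unfolding tangent_space_def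
    by (meson IntE IntI less_le_trans order_trans subsetD)
qed

text \<open>The mean value inequality is applied twice: once to \<open>f'\<close>, which is
  \<open>B\<close>-Lipschitz on \<open>U\<close>, and once to \<open>f\<close> minus its
  linearization along the segment. This gives the constant \<open>B\<close> rather than the sharp
  \<open>B / 2\<close>, which is enough.\<close>

lemma second_order_remainder:
  fixes f :: "'a::real_normed_vector \<Rightarrow> 'b::real_normed_vector"
  assumes "convex U" and q: "q \<in> U" "q' \<in> U"
    and f': "\<And>x. x \<in> U \<Longrightarrow> (f has_derivative blinfun_apply (f' x)) (at x)"
    and f'': "\<And>x. x \<in> U \<Longrightarrow> (f' has_derivative blinfun_apply (f'' x)) (at x)"
    and B: "\<And>x. x \<in> U \<Longrightarrow> norm (f'' x) \<le> B"
  shows "norm (f q' - f q - f' q (q' - q)) \<le> B * (norm (q' - q))\<^sup>2"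
proof -
  have seg: "closed_segment q q' \<subseteq> U"
    using \<open>convex U\<close> q by (simp add: closed_segment_subset)
  have "0 \<le> B" using B[OF q(1)] norm_ge_zero order_trans by blast
  have lip: "norm (f' x - f' q) \<le> B * norm (x - q)" if "x \<in> U" for x
    by (rule differentiable_bound[OF \<open>convex U\<close>, where f' = "\<lambda>x. blinfun_apply (f'' x)"])
      (use f'' B that q in \<open>auto simp: norm_blinfun.rep_eq[symmetric] intro: has_derivative_at_withinI\<close>)
  have "onorm (\<lambda>v. f' x v - f' q v) \<le> B * norm (q' - q)" if x: "x \<in> closed_segment q q'" for x
  proof -
    have "onorm (\<lambda>v. f' x v - f' q v) = norm (f' x - f' q)"
      by (simp add: norm_blinfun.rep_eq minus_blinfun.rep_eq)
    also have "\<dots> \<le> B * norm (x - q)" using lip seg x by blast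
    also have "\<dots> \<le> B * norm (q' - q)"
      using segment_bound(1)[OF x] \<open>0 \<le> B\<close> by (simp add: mult_left_mono norm_minus_commute)
    finally show ?thesis .
  qed
  moreover have "q + t *\<^sub>R (q' - q) \<in> closed_segment q q'" if "t \<in> {0..1}" for t
    using that unfolding in_segment by (auto simp: algebra_simps intro!: exI[of _ t])
  moreover have "(f has_derivative blinfun_apply (f' x)) (at x within closed_segment q q')"
    if "x \<in> closed_segment q q'" for x
    using f' seg that by (blast intro: has_derivative_at_withinI)
  ultimately have "norm (f q' - f q - f' q (q' - q)) \<le> norm (q' - q) * (B * norm (q' - q))"
    by (intro differentiable_bound_linearization[where S = "closed_segment q q'"
          and f' = "\<lambda>x. blinfun_apply (f' x)"]) (simp_all add: fun_diff_def)
  then show ?thesis by (simp add: power2_eq_square mult_ac)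
qed

lemma isCont_eventually_norm_less:
  fixes f :: "'a::t2_space \<Rightarrow> 'b::real_normed_vector"
  assumes "isCont f x" and "norm (f x) < b"
  shows "\<forall>\<^sub>F y in nhds x. norm (f y) < b"
proof -
  have "(f \<longlongrightarrow> f x) (nhds x)"
    using isContD[OF assms(1)] tendsto_at_iff_tendsto_nhds by blast
  then show ?thesis using assms(2) by (intro order_tendstoD(2)[OF tendsto_norm])
qed

text \<open>The tangent space at \<open>a\<close> is the image of \<open>L\<close> under the
  derivative of \<psi> at \<phi> a, and both clauses are Taylor expansions of \<psi> there. One
  \<open>r\<close> serves all \<open>a\<close> near \<open>p\<close>, since the bounds on the
  derivative of \<phi> and the second derivative of \<psi> at \<open>p\<close> persist nearby up to
  a slack of 1.\<close>

lemma local_tangent_spaces: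
  fixes S :: "'a::euclidean_space set"
  assumes "C2_submanifold k S" and "p \<in> S"
  shows "\<exists>r>0. \<forall>a\<in>S \<inter> ball p r. \<exists>T. tangent_space r S (ball p r) a T"
proof -
  obtain U V L :: "'a set" and \<phi> \<psi> :: "'a \<Rightarrow> 'a"
    where "open U" "p \<in> U" "open V" and L: "subspace L"
    and hom: "homeomorphism U V \<phi> \<psi>" and C2: "C2_on \<phi> U" "C2_on \<psi> V"
    and flat: "\<phi> ` (S \<inter> U) = L \<inter> V"
    using bspec[OF assms(1)[unfolded C2_submanifold_def] assms(2)] by (elim exE conjE) (rule that)
  obtain \<phi>' \<phi>'' where \<phi>': "\<And>x. x \<in> U \<Longrightarrow> (\<phi> has_derivative blinfun_apply (\<phi>' x)) (at x)"
    and \<phi>'': "\<And>x. x \<in> U \<Longrightarrow> (\<phi>' has_derivative blinfun_apply (\<phi>'' x)) (at x)"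
    using C2(1) unfolding C2_on_def by blast
  obtain \<psi>' \<psi>'' where \<psi>': "\<And>x. x \<in> V \<Longrightarrow> (\<psi> has_derivative blinfun_apply (\<psi>' x)) (at x)"
    and \<psi>'': "\<And>x. x \<in> V \<Longrightarrow> (\<psi>' has_derivative blinfun_apply (\<psi>'' x)) (at x)"
    and cont: "continuous_on V \<psi>''"
    using C2(2) unfolding C2_on_def by blast
  have inv: "\<And>x. x \<in> U \<Longrightarrow> \<psi> (\<phi> x) = x" "\<And>y. y \<in> V \<Longrightarrow> \<phi> (\<psi> y) = y"
    and im: "\<And>x. x \<in> U \<Longrightarrow> \<phi> x \<in> V" "\<And>y. y \<in> V \<Longrightarrow> \<psi> y \<in> U"
    using hom unfolding homeomorphism_def by auto
  define q where "q = \<phi> p"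
  have "q \<in> V" using im \<open>p \<in> U\<close> q_def by blast
  define B where "B = norm (\<phi>' p) + norm (\<psi>'' q) + 1"
  have "B \<ge> 1" by (simp add: B_def)
  have "isCont \<psi>'' q"
    using cont \<open>open V\<close> \<open>q \<in> V\<close> by (simp add: continuous_on_eq_continuous_at)
  then have "\<forall>\<^sub>F y in nhds q. norm (\<psi>'' y) < B"
    by (rule isCont_eventually_norm_less) (simp add: B_def add_nonneg_pos)
  moreover have "\<forall>\<^sub>F y in nhds q. y \<in> V" using \<open>open V\<close> \<open>q \<in> V\<close> by (rule eventually_nhds_in_open)
  ultimately have "\<forall>\<^sub>F y in nhds q. norm (\<psi>'' y) < B \<and> y \<in> V" by (rule eventually_conj)
  then obtain d where "d > 0" and d: "\<And>y. dist y q < d \<Longrightarrow> norm (\<psi>'' y) < B \<and> y \<in> V"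
    unfolding eventually_nhds_metric by blast
  have "isCont \<phi>' p" using \<phi>''[OF \<open>p \<in> U\<close>] by (rule has_derivative_continuous)
  then have "\<forall>\<^sub>F y in nhds p. norm (\<phi>' y) < B"
    by (rule isCont_eventually_norm_less) (simp add: B_def add_nonneg_pos)
  moreover have "\<forall>\<^sub>F y in nhds p. y \<in> U" using \<open>open U\<close> \<open>p \<in> U\<close> by (rule eventually_nhds_in_open)
  moreover have "\<forall>\<^sub>F y in nhds p. dist (\<phi> y) q < d / 2"
    using has_derivative_continuous[OF \<phi>'[OF \<open>p \<in> U\<close>]] \<open>d > 0\<close> q_def
    by (metis half_gt_zero isContD tendstoD tendsto_at_iff_tendsto_nhds)
  ultimately have "\<forall>\<^sub>F y in nhds p. norm (\<phi>' y) < B \<and> y \<in> U \<and> dist (\<phi> y) q < d / 2"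
    by (simp add: eventually_conj_iff)
  then obtain e where "e > 0"
    and e: "\<And>y. dist y p < e \<Longrightarrow> norm (\<phi>' y) < B \<and> y \<in> U \<and> dist (\<phi> y) q < d / 2"
    unfolding eventually_nhds_metric by blast
  \<comment> \<open>The three terms keep points in the region where the bounds on \<phi> hold, keep
    the chart displacement \<open>l\<close> of a tangent vector within \<open>d / 2\<close>, and
    absorb the Taylor error: a displacement of size at most B m in the chart costs B (B m)^2 = B^3
    m^2.\<close>
  define r where "r = min e (min (d / (2 * B)) (1 / B ^ 3))"
  have "r > 0" using \<open>e > 0\<close> \<open>d > 0\<close> \<open>B \<ge> 1\<close> by (auto simp: r_def)
  have r: "r \<le> e" "B * r \<le> d / 2" "B ^ 3 \<le> 1 / r"
  proof -
    show "r \<le> e" by (simp add: r_def)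
    have "r \<le> d / (2 * B)" by (simp add: r_def)
    then show "B * r \<le> d / 2" using \<open>B \<ge> 1\<close> by (simp add: field_simps)
    have "r \<le> 1 / B ^ 3" by (simp add: r_def)
    then show "B ^ 3 \<le> 1 / r" using \<open>B \<ge> 1\<close> \<open>r > 0\<close> by (simp add: field_simps)
  qed
  have taylor: "norm (\<psi> v' - \<psi> v - \<psi>' v (v' - v)) \<le> B * (norm (v' - v))\<^sup>2"
    if "v \<in> ball q d" "v' \<in> ball q d" for v v'
    by (rule second_order_remainder[OF convex_ball that, where f'' = \<psi>''])
      (use \<psi>' \<psi>'' d in \<open>auto simp: dist_commute less_imp_le\<close>)
  have square: "B * n\<^sup>2 \<le> m\<^sup>2 / r" if "0 \<le> n" "n \<le> B * m" for n m :: real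
  proof -
    have "B * n\<^sup>2 \<le> B * (B * m)\<^sup>2" using that \<open>B \<ge> 1\<close> by (intro mult_left_mono power_mono) auto
    also have "\<dots> = B ^ 3 * m\<^sup>2" by (simp add: power2_eq_square power3_eq_cube)
    also have "\<dots> \<le> 1 / r * m\<^sup>2" by (rule mult_right_mono[OF r(3)]) simp
    finally show ?thesis by simp
  qed
  show ?thesis
  proof (intro exI[of _ r] conjI ballI \<open>r > 0\<close>)
    fix a assume a: "a \<in> S \<inter> ball p r"
    then have a': "a \<in> U" "norm (\<phi>' a) < B" "dist (\<phi> a) q < d / 2"
      using e[of a] r(1) by (auto simp: dist_commute)
    have "\<phi> a \<in> L" using a a' flat by blast
    show "\<exists>T. tangent_space r S (ball p r) a T"
      unfolding tangent_space_def
    proof (intro exI[of _ "\<psi>' (\<phi> a) ` L"] conjI ballI impI)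
      show "subspace (\<psi>' (\<phi> a) ` L)"
        using L by (intro linear_subspace_image) (simp_all add: bounded_linear.linear blinfun.bounded_linear_right)
    next
      fix y assume y: "y \<in> S \<inter> ball p r"
      then have y': "y \<in> U" "dist (\<phi> y) q < d / 2"
        using e[of y] r(1) by (auto simp: dist_commute)
      have "\<phi> y \<in> L" using y y' flat by blast
      have "norm (\<phi> y - \<phi> a) \<le> B * norm (y - a)"
      proof (rule differentiable_bound[OF convex_ball])
        fix x assume "x \<in> ball p r"
        then have x: "x \<in> U" "norm (\<phi>' x) \<le> B"
          using e[of x] r(1) by (auto simp: dist_commute)
        show "(\<phi> has_derivative blinfun_apply (\<phi>' x)) (at x within ball p r)"
          using \<phi>'[OF x(1)] by (rule has_derivative_at_withinI)
        show "onorm (blinfun_apply (\<phi>' x)) \<le> B" using x(2) by (simp add: norm_blinfun.rep_eq)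
      qed (use a y in auto)
      then have "B * (norm (\<phi> y - \<phi> a))\<^sup>2 \<le> (norm (y - a))\<^sup>2 / r" by (intro square) auto
      moreover have "norm (\<psi> (\<phi> y) - \<psi> (\<phi> a) - \<psi>' (\<phi> a) (\<phi> y - \<phi> a)) \<le> B * (norm (\<phi> y - \<phi> a))\<^sup>2"
        using a'(3) y'(2) by (intro taylor) (use \<open>d > 0\<close> in \<open>auto simp: dist_commute\<close>)
      moreover have "\<phi> y - \<phi> a \<in> L" using L \<open>\<phi> y \<in> L\<close> \<open>\<phi> a \<in> L\<close> by (rule subspace_diff)
      ultimately show "\<exists>t\<in>\<psi>' (\<phi> a) ` L. norm (y - a - t) \<le> (norm (y - a))\<^sup>2 / r"
        using inv a' y' by force
    next
      fix w assume "w \<in> \<psi>' (\<phi> a) ` L" and w: "norm w < r"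
      then obtain l where l: "l \<in> L" "w = \<psi>' (\<phi> a) l" by blast
      have "\<phi> a \<in> V" using a' im by blast
      \<comment> \<open>Differentiating \<phi> o \<psi> = id shows that the derivative of \<phi> at
        \<open>a\<close> recovers \<open>l\<close> from \<open>w\<close>; this bounds
        \<open>l\<close> by B times the norm of \<open>w\<close>.\<close>
      have "(\<phi> has_derivative \<phi>' a) (at (\<psi> (\<phi> a)))" using \<phi>' a' inv by simp
      then have "((\<lambda>v. \<phi> (\<psi> v)) has_derivative (\<lambda>v. \<phi>' a (\<psi>' (\<phi> a) v))) (at (\<phi> a))"
        by (rule has_derivative_compose[OF \<psi>'[OF \<open>\<phi> a \<in> V\<close>]])
      then have "((\<lambda>v. v) has_derivative (\<lambda>v. \<phi>' a (\<psi>' (\<phi> a) v))) (at (\<phi> a))"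
        by (rule has_derivative_transform_within_open[OF _ \<open>open V\<close> \<open>\<phi> a \<in> V\<close>]) (rule inv)
      then have "(\<lambda>v. \<phi>' a (\<psi>' (\<phi> a) v)) = (\<lambda>v. v)"
        using has_derivative_ident by (rule has_derivative_unique)
      then have "l = \<phi>' a w" using l by (metis (full_types))
      then have "norm l \<le> norm (\<phi>' a) * norm w" by (simp add: norm_blinfun)
      also have "\<dots> \<le> B * norm w" using a' by (intro mult_right_mono) auto
      finally have nl: "norm l \<le> B * norm w" .
      also have "\<dots> < B * r" using w \<open>B \<ge> 1\<close> by simp
      finally have "norm l < d / 2" using r by simp
      then have "dist (\<phi> a + l) q < d"
        using a'(3) norm_triangle_ineq[of "\<phi> a - q" l] by (simp add: dist_norm algebra_simps)
      then have v: "\<phi> a + l \<in> ball q d" "\<phi> a + l \<in> V" using d by (auto simp: dist_commute)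
      moreover have "\<phi> a + l \<in> L" using L \<open>\<phi> a \<in> L\<close> l by (simp add: subspace_add)
      ultimately have "\<phi> a + l \<in> \<phi> ` (S \<inter> U)" using flat by blast
      then have "\<psi> (\<phi> a + l) \<in> S" using inv by auto
      moreover have "norm (\<psi> (\<phi> a + l) - \<psi> (\<phi> a) - \<psi>' (\<phi> a) (\<phi> a + l - \<phi> a))
          \<le> B * (norm (\<phi> a + l - \<phi> a))\<^sup>2"
        using a' v \<open>d > 0\<close> by (intro taylor) (auto simp: dist_commute)
      moreover have "B * (norm l)\<^sup>2 \<le> (norm w)\<^sup>2 / r" using nl by (intro square) auto
      ultimately show "\<exists>y\<in>S. norm (y - a - w) \<le> (norm w)\<^sup>2 / r"
        using l inv a' by (intro bexI[of _ "\<psi> (\<phi> a + l)"]) auto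
    qed
  qed
qed

text \<open>Compactness makes the scale uniform. The cover uses half radii so that a ball of radius
  \<open>r\<close> around any point of \<open>S\<close> fits inside one of the finitely many full
  chart balls.\<close>

lemma ex_tangent_spaces:
  fixes S :: "'a::euclidean_space set"
  assumes "compact S" and "C2_submanifold k S"
  obtains r T where "r > 0" "\<And>a. a \<in> S \<Longrightarrow> tangent_space r S (ball a r) a (T a)"
proof -
  have "\<forall>p\<in>S. \<exists>r. r > 0 \<and> (\<forall>a\<in>S \<inter> ball p r. \<exists>T. tangent_space r S (ball p r) a T)"
    using local_tangent_spaces[OF assms(2)] by simp
  from bchoice[OF this] obtain R where R: "\<And>p. p \<in> S \<Longrightarrow> R p > 0"
    and loc: "\<And>p a. p \<in> S \<Longrightarrow> a \<in> S \<inter> ball p (R p) \<Longrightarrow> \<exists>T. tangent_space (R p) S (ball p (R p)) a T"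
    by blast
  have "\<And>p. p \<in> S \<Longrightarrow> open (ball p (R p / 2))" by simp
  moreover have "S \<subseteq> (\<Union>p\<in>S. ball p (R p / 2))" using R by fastforce
  ultimately obtain D where D: "D \<subseteq> S" "finite D" "S \<subseteq> (\<Union>p\<in>D. ball p (R p / 2))"
    by (rule compactE_image[OF \<open>compact S\<close>, where C = S and f = "\<lambda>p. ball p (R p / 2)"])
  \<comment> \<open>Inserting 1 keeps the minimum meaningful when \<open>S\<close>, and with it
    possibly \<open>D\<close>, is empty.\<close>
  define r where "r = Min (insert 1 ((\<lambda>p. R p / 2) ` D))"
  have "r > 0" using D R by (auto simp: r_def)
  have "\<exists>T. tangent_space r S (ball a r) a T" if "a \<in> S" for a
  proof -
    obtain p where p: "p \<in> D" "dist p a < R p / 2" using D(3) \<open>a \<in> S\<close> by auto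
    have "p \<in> S" using p D by blast
    have rp: "r \<le> R p / 2" using D p unfolding r_def by (intro Min_le) auto
    have sub: "ball a r \<subseteq> ball p (R p)"
    proof
      fix y assume "y \<in> ball a r"
      then show "y \<in> ball p (R p)" using p rp dist_triangle[of p y a] by simp
    qed
    moreover have "r \<le> R p" using rp R[OF \<open>p \<in> S\<close>] by simp
    moreover have "\<exists>T. tangent_space (R p) S (ball p (R p)) a T"
      using loc \<open>p \<in> S\<close> \<open>a \<in> S\<close> p(2) R[OF \<open>p \<in> S\<close>] by auto
    ultimately show ?thesis using tangent_space_mono \<open>r > 0\<close> by blast
  qed
  then show thesis using that \<open>r > 0\<close> by metis
qed

section \<open>Nearest points and gaps between subspaces\<close>

lemma dist_le_iff_inner:
  fixes a y z :: "'a::real_inner"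
  shows "dist z a \<le> dist z y \<longleftrightarrow> 2 * ((z - a) \<bullet> (y - a)) \<le> (norm (y - a))\<^sup>2"
proof -
  have "(norm (z - y))\<^sup>2 = (norm (z - a))\<^sup>2 - 2 * ((z - a) \<bullet> (y - a)) + (norm (y - a))\<^sup>2"
    by (simp add: power2_norm_eq_inner inner_diff inner_commute)
  moreover have "dist z a \<le> dist z y \<longleftrightarrow> (norm (z - a))\<^sup>2 \<le> (norm (z - y))\<^sup>2"
    by (simp add: dist_norm)
  ultimately show ?thesis by simp
qed

text \<open>First variation: comparing \<open>a\<close> with a point of \<open>S\<close> close to a
  + t v shows that t times the inner product with v is O(t^2), so the inner product is nonpositive.
  Applying this to \<open>w\<close> and \<open>- w\<close> gives orthogonality.\<close>

lemma nearest_point_inner_tangent: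
  assumes T: "tangent_space r S N a T" and "0 < r"
    and nearest: "\<forall>y\<in>S. dist z a \<le> dist z y" and "w \<in> T"
  shows "(z - a) \<bullet> w = 0"
proof -
  have le: "(z - a) \<bullet> v \<le> 0" if "v \<in> T" for v
  proof -
    \<comment> \<open>\<open>A\<close> collects the two second-order errors: half of (2 t |v|)^2
      from the comparison of distances, and the deviation of \<open>y\<close> from a + t v paired
      with z - a, each divided by t^2.\<close>
    define A where "A = 2 * (norm v)\<^sup>2 + norm (z - a) * (norm v)\<^sup>2 / r"
    define t0 where "t0 = r / (norm v + 1)"
    have "0 \<le> A" using \<open>0 < r\<close> by (simp add: A_def)
    have "0 < t0" using \<open>0 < r\<close> by (simp add: t0_def add_nonneg_pos)
    have bound: "(z - a) \<bullet> v \<le> t * A" if t: "0 < t" "t < t0" for t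
    proof -
      have "0 < norm v + 1" by (simp add: add_nonneg_pos)
      then have "t * (norm v + 1) < r" using t by (simp add: t0_def pos_less_divide_eq)
      then have tv: "t * norm v < r" using \<open>0 < t\<close> by (simp add: algebra_simps)
      have "t *\<^sub>R v \<in> T" using T \<open>v \<in> T\<close> by (simp add: tangent_space_def subspace_scale)
      then obtain y where "y \<in> S" and y: "norm (y - a - t *\<^sub>R v) \<le> (t * norm v)\<^sup>2 / r"
        using T tv \<open>0 < t\<close> unfolding tangent_space_def by (metis abs_of_pos norm_scaleR)
      have "(t * norm v)\<^sup>2 / r = (t * norm v) * (t * norm v / r)" by (simp add: power2_eq_square)
      also have "\<dots> \<le> (t * norm v) * 1"
        using tv \<open>0 < t\<close> \<open>0 < r\<close> by (intro mult_left_mono) auto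
      finally have "norm (y - a) \<le> 2 * (t * norm v)"
        using y norm_triangle_ineq[of "y - a - t *\<^sub>R v" "t *\<^sub>R v"] \<open>0 < t\<close> by simp
      then have "(norm (y - a))\<^sup>2 \<le> (2 * (t * norm v))\<^sup>2" by (intro power_mono) auto
      moreover have "2 * ((z - a) \<bullet> (y - a)) \<le> (norm (y - a))\<^sup>2"
        using nearest \<open>y \<in> S\<close> dist_le_iff_inner by blast
      moreover have "\<bar>(z - a) \<bullet> (y - a - t *\<^sub>R v)\<bar> \<le> norm (z - a) * ((t * norm v)\<^sup>2 / r)"
        by (rule order_trans[OF Cauchy_Schwarz_ineq2 mult_left_mono[OF y]]) simp
      ultimately have "t * ((z - a) \<bullet> v) \<le> 2 * (t * norm v)\<^sup>2 + norm (z - a) * ((t * norm v)\<^sup>2 / r)"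
        by (simp add: inner_diff_right power_mult_distrib)
      also have "\<dots> = t * (t * A)" by (simp add: A_def power2_eq_square algebra_simps)
      finally show ?thesis using \<open>0 < t\<close> by simp
    qed
    show ?thesis
    proof (rule ccontr)
      assume "\<not> (z - a) \<bullet> v \<le> 0"
      then have c: "0 < (z - a) \<bullet> v" by simp
      \<comment> \<open>With this \<open>t\<close> the product t A stays strictly below the
        supposedly positive inner product; A + 1 replaces \<open>A\<close> because \<open>A\<close>
        may vanish.\<close>
      define t where "t = min (t0 / 2) ((z - a) \<bullet> v / (2 * (A + 1)))"
      have "0 < t" "t < t0" using c \<open>0 < t0\<close> \<open>0 \<le> A\<close> by (auto simp: t_def)
      have "t * A \<le> (z - a) \<bullet> v / (2 * (A + 1)) * A"
        using \<open>0 \<le> A\<close> by (intro mult_right_mono) (simp_all add: t_def)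
      also have "\<dots> = (z - a) \<bullet> v * (A / (2 * (A + 1)))" by simp
      also have "\<dots> < (z - a) \<bullet> v * 1"
        using c \<open>0 \<le> A\<close> by (intro mult_strict_left_mono) (simp_all add: field_simps)
      finally show False using bound[OF \<open>0 < t\<close> \<open>t < t0\<close>] by simp
    qed
  qed
  moreover have "- w \<in> T" using T \<open>w \<in> T\<close> by (simp add: tangent_space_def subspace_neg)
  ultimately have "(z - a) \<bullet> w \<le> 0" "(z - a) \<bullet> (- w) \<le> 0" using \<open>w \<in> T\<close> by blast+
  then show ?thesis by simp
qed

text \<open>Let \<open>z\<close> have two nearest points \<open>a\<close>, \<open>b\<close>. If they
  are at least \<open>r\<close> apart, the triangle inequality suffices. Otherwise b - a is tangent
  at \<open>a\<close> up to |b - a|^2 / r, so its inner product with z - a is at most |z - a| |b -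
  a|^2 / r, whereas equidistance forces at least |b - a|^2 / 2.\<close>

lemma reach_ge_half:
  assumes "0 < r" and T: "\<And>a. a \<in> S \<Longrightarrow> tangent_space r S (ball a r) a (T a)"
  shows "ereal (r / 2) \<le> reach S"
  unfolding reach_def
proof (intro INF_greatest)
  fix x z assume "x \<in> S" "z \<in> medial_axis S"
  then obtain a b where ab: "a \<in> S" "b \<in> S" "a \<noteq> b"
    and a: "\<forall>y\<in>S. dist z a \<le> dist z y" and b: "\<forall>y\<in>S. dist z b \<le> dist z y"
    unfolding medial_axis_def by blast
  have "dist z b \<le> dist z a" using ab b by blast
  have "r \<le> 2 * dist z a"
  proof (cases "norm (b - a) < r")
    case True
    then have "b \<in> S \<inter> ball a r" using \<open>b \<in> S\<close> by (simp add: dist_norm norm_minus_commute)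
    then obtain t where "t \<in> T a" and t: "norm (b - a - t) \<le> (norm (b - a))\<^sup>2 / r"
      using T[OF \<open>a \<in> S\<close>] unfolding tangent_space_def by blast
    have "(z - a) \<bullet> t = 0"
      by (rule nearest_point_inner_tangent[OF T[OF \<open>a \<in> S\<close>] \<open>0 < r\<close> a \<open>t \<in> T a\<close>])
    then have "(z - a) \<bullet> (b - a) = (z - a) \<bullet> (b - a - t)" by (simp add: inner_diff_right)
    also have "\<dots> \<le> norm (z - a) * ((norm (b - a))\<^sup>2 / r)"
      by (rule order_trans[OF norm_cauchy_schwarz mult_left_mono[OF t]]) simp
    finally have "(z - a) \<bullet> (b - a) \<le> norm (z - a) * ((norm (b - a))\<^sup>2 / r)" .
    moreover have "(z - b) \<bullet> (a - b) \<le> (z - a) \<bullet> (b - a)"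
    proof -
      have "(norm (z - b))\<^sup>2 \<le> (norm (z - a))\<^sup>2" using \<open>dist z b \<le> dist z a\<close> by (simp add: dist_norm)
      then show ?thesis by (simp add: power2_norm_eq_inner inner_diff inner_commute)
    qed
    moreover have "(z - b) \<bullet> (a - b) + (z - a) \<bullet> (b - a) = (norm (b - a))\<^sup>2"
      by (simp add: power2_norm_eq_inner inner_diff inner_commute)
    ultimately have "(norm (b - a))\<^sup>2 \<le> 2 * (norm (z - a) * ((norm (b - a))\<^sup>2 / r))" by linarith
    then have "(norm (b - a))\<^sup>2 * 1 \<le> (norm (b - a))\<^sup>2 * (2 * norm (z - a) / r)" by (simp add: ac_simps)
    moreover have "0 < (norm (b - a))\<^sup>2" using \<open>a \<noteq> b\<close> by simp
    ultimately have "1 \<le> 2 * norm (z - a) / r" by (simp only: mult_le_cancel_left_pos)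
    then show ?thesis using \<open>0 < r\<close> by (simp add: dist_norm field_simps)
  next
    case False
    then show ?thesis using \<open>dist z b \<le> dist z a\<close> dist_triangle[of b a z]
      by (simp add: dist_norm norm_minus_commute)
  qed
  then show "ereal (r / 2) \<le> ereal (dist x z)"
    using a \<open>x \<in> S\<close> by (fastforce simp: dist_commute)
qed

text \<open>One-sided: \<open>gap_le A B g\<close> says that the sine of the angle between a vector of \<open>A\<close> and \<open>B\<close> is at
  most \<open>g\<close>. No equality of dimensions is assumed, so the two directions are independent.\<close>

definition gap_le :: "'a::euclidean_space set \<Rightarrow> 'a set \<Rightarrow> real \<Rightarrow> bool" where
  "gap_le A B g \<longleftrightarrow> (\<forall>w\<in>A. \<forall>n\<in>orthogonal_comp B. w \<bullet> n \<le> g * norm w * norm n)"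

section \<open>Orthogonal splittings and the composition of angle bounds\<close>

lemma orthogonal_decomp:
  fixes x :: "'a::euclidean_space"
  assumes "subspace B"
  obtains t m where "t \<in> B" "m \<in> orthogonal_comp B" "x = t + m"
    "norm t \<le> norm x" "norm m \<le> norm x"
proof -
  obtain t m where "t \<in> span B" and m: "\<And>w. w \<in> span B \<Longrightarrow> orthogonal m w" and x: "x = t + m"
    using orthogonal_subspace_decomp_exists[of B x] by blast
  have "span B = B" using assms by simp
  have "(norm x)\<^sup>2 = (norm t)\<^sup>2 + (norm m)\<^sup>2"
    using m[OF \<open>t \<in> span B\<close>] unfolding x
    by (intro norm_add_Pythagorean) (simp add: orthogonal_commute)
  then have "(norm t)\<^sup>2 \<le> (norm x)\<^sup>2" "(norm m)\<^sup>2 \<le> (norm x)\<^sup>2" by simp_all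
  then have "norm t \<le> norm x" "norm m \<le> norm x" by (auto intro: power2_le_imp_le)
  moreover have "m \<in> orthogonal_comp B"
    using m unfolding \<open>span B = B\<close> by (auto simp: orthogonal_comp_def orthogonal_def inner_commute)
  ultimately show thesis using that \<open>t \<in> span B\<close> \<open>span B = B\<close> x by metis
qed

lemma orthogonal_comp_inner: "m \<in> orthogonal_comp B \<Longrightarrow> t \<in> B \<Longrightarrow> t \<bullet> m = 0"
  by (auto simp: orthogonal_comp_def orthogonal_def)

lemma gap_leE:
  assumes "gap_le A B g" "subspace B" "w \<in> A" "0 \<le> g"
  obtains t m where "t \<in> B" "m \<in> orthogonal_comp B" "w = t + m" "norm t \<le> norm w" "norm m \<le> g * norm w"
proof -
  obtain t m where tm: "t \<in> B" "m \<in> orthogonal_comp B" "w = t + m" "norm t \<le> norm w"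
    using orthogonal_decomp[OF assms(2)] by metis
  have "norm m * norm m = w \<bullet> m"
    using orthogonal_comp_inner[OF tm(2,1)] by (simp add: tm(3) inner_add_left flip: power2_eq_square power2_norm_eq_inner)
  also have "\<dots> \<le> g * norm w * norm m" using assms tm unfolding gap_le_def by blast
  finally have "norm m \<le> g * norm w"
    using mult_le_cancel_right_pos[of "norm m"] \<open>0 \<le> g\<close> by (cases "norm m = 0") auto
  with tm that show thesis by blast
qed

lemma gap_le_refl: "gap_le A A 0"
  by (auto simp: gap_le_def orthogonal_comp_inner)

lemma gap_le_mono:
  assumes "gap_le A B g" "g \<le> h"
  shows "gap_le A B h"
  unfolding gap_le_def
proof (intro ballI)
  fix w n assume "w \<in> A" "n \<in> orthogonal_comp B"
  then have "w \<bullet> n \<le> g * norm w * norm n" using assms by (simp add: gap_le_def)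
  also have "\<dots> \<le> h * norm w * norm n" using assms by (intro mult_right_mono) auto
  finally show "w \<bullet> n \<le> h * norm w * norm n" .
qed

text \<open>Sines of angles are subadditive: split \<open>w\<close> along \<open>B\<close>, use the
  second bound on the part in \<open>B\<close> and Cauchy-Schwarz on the rest. Many small gaps along
  a path can thus be summed.\<close>

lemma gap_le_trans:
  assumes "gap_le A B g" "gap_le B C h" "subspace B" "0 \<le> g" "0 \<le> h"
  shows "gap_le A C (g + h)"
  unfolding gap_le_def
proof (intro ballI)
  fix w n assume "w \<in> A" and n: "n \<in> orthogonal_comp C"
  obtain t m where tm: "t \<in> B" "w = t + m" "norm t \<le> norm w" "norm m \<le> g * norm w"
    using gap_leE[OF assms(1,3) \<open>w \<in> A\<close> \<open>0 \<le> g\<close>] by metis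
  have "t \<bullet> n \<le> h * norm t * norm n" using assms(2) tm n by (auto simp: gap_le_def)
  also have "\<dots> \<le> h * norm w * norm n" using tm(3) \<open>0 \<le> h\<close> by (intro mult_left_mono mult_right_mono) auto
  finally have "t \<bullet> n \<le> h * norm w * norm n" .
  moreover have "m \<bullet> n \<le> g * norm w * norm n"
    by (rule order_trans[OF norm_cauchy_schwarz mult_right_mono[OF tm(4)]]) simp
  ultimately show "w \<bullet> n \<le> (g + h) * norm w * norm n" by (simp add: tm(2) inner_add_left algebra_simps)
qed

text \<open>Let \<open>v\<close> be the \<open>A\<close>-component of a normal \<open>n\<close> of
  \<open>B\<close>. Some point \<open>y\<close> of \<open>Y\<close> lies roughly at distance
  \<open>h\<close> from \<open>a\<close> in the direction of \<open>v\<close>, so v has inner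
  product at least h |v| / 2 with y - a. But \<open>n\<close> is almost orthogonal to y - a, and so
  is its part \<open>m\<close> normal to \<open>A\<close>; hence \<open>v\<close> is short. The
  constant 9 / 8 is (3 / 2)^2 / 2. The set \<open>Y\<close> is a whole surface in one application
  and the sample in another.\<close>

lemma gap_le_from_points:
  assumes "subspace A" "0 < h" "0 < \<rho>" "0 \<le> K"
    and dense: "\<And>w. w \<in> A \<Longrightarrow> norm w = h \<Longrightarrow> \<exists>y\<in>Y. norm (y - a - w) \<le> h / 2"
    and normal_A: "\<And>m y. m \<in> orthogonal_comp A \<Longrightarrow> y \<in> Y \<Longrightarrow> m \<bullet> (y - a) \<le> norm m * (norm (y - a))\<^sup>2 / (2 * \<rho>)"
    and normal_B: "\<And>n y. n \<in> orthogonal_comp B \<Longrightarrow> y \<in> Y \<Longrightarrow> norm (y - a) \<le> 3 / 2 * h \<Longrightarrow> n \<bullet> (y - a) \<le> K * norm n"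
  shows "gap_le A B (2 * (K + 9 / 8 * h\<^sup>2 / \<rho>) / h)"
  unfolding gap_le_def
proof (intro ballI)
  fix w n assume "w \<in> A" and n: "n \<in> orthogonal_comp B"
  obtain v m where v: "v \<in> A" and m: "m \<in> orthogonal_comp A" and vm: "n = v + m" "norm m \<le> norm n"
    using orthogonal_decomp[OF \<open>subspace A\<close>] by metis
  let ?g = "2 * (K + 9 / 8 * h\<^sup>2 / \<rho>) / h"
  have "norm v \<le> ?g * norm n"
  proof (cases "v = 0")
    case False
    define w0 where "w0 = (h / norm v) *\<^sub>R v"
    have "norm w0 = h" using False \<open>0 < h\<close> by (simp add: w0_def)
    moreover have "w0 \<in> A" using v \<open>subspace A\<close> by (simp add: w0_def subspace_scale)
    ultimately obtain y where "y \<in> Y" and y: "norm (y - a - w0) \<le> h / 2" using dense by blast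
    have ya: "norm (y - a) \<le> 3 / 2 * h"
      using y norm_triangle_ineq[of "y - a - w0" w0] \<open>norm w0 = h\<close> by simp
    have "- m \<in> orthogonal_comp A" using m by (auto simp: orthogonal_comp_def orthogonal_def)
    then have "- (m \<bullet> (y - a)) \<le> norm m * (norm (y - a))\<^sup>2 / (2 * \<rho>)"
      using normal_A[of "- m" y] \<open>y \<in> Y\<close> by simp
    also have "\<dots> \<le> norm n * (3 / 2 * h)\<^sup>2 / (2 * \<rho>)"
      using vm(2) ya \<open>0 < \<rho>\<close> by (intro divide_right_mono mult_mono power_mono) auto
    finally have 1: "- (m \<bullet> (y - a)) \<le> 9 / 8 * h\<^sup>2 / \<rho> * norm n"
      by (simp add: power2_eq_square field_simps)
    have 2: "n \<bullet> (y - a) \<le> K * norm n" using normal_B[OF n \<open>y \<in> Y\<close> ya] .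
    have "v \<bullet> w0 = h * norm v" using False by (simp add: w0_def field_simps flip: power2_eq_square power2_norm_eq_inner)
    moreover have "\<bar>v \<bullet> (y - a - w0)\<bar> \<le> norm v * (h / 2)"
      by (rule order_trans[OF Cauchy_Schwarz_ineq2 mult_left_mono[OF y]]) simp
    moreover have "v \<bullet> (y - a - w0) = v \<bullet> (y - a) - v \<bullet> w0" by (rule inner_diff_right)
    ultimately have "h * norm v / 2 \<le> v \<bullet> (y - a)"
      by (simp only: abs_le_iff) (simp add: mult.commute)
    also have "\<dots> = n \<bullet> (y - a) - m \<bullet> (y - a)" by (simp add: vm(1) inner_add_left)
    also have "\<dots> \<le> (K + 9 / 8 * h\<^sup>2 / \<rho>) * norm n" using 1 2 by (simp add: algebra_simps)
    finally show ?thesis using \<open>0 < h\<close> by (simp add: field_simps)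
  qed (use assms in auto)
  moreover have "w \<bullet> n \<le> norm w * norm v"
    using orthogonal_comp_inner[OF m \<open>w \<in> A\<close>] norm_cauchy_schwarz[of w v] by (simp add: vm(1) inner_add_right)
  ultimately have "w \<bullet> n \<le> norm w * (?g * norm n)"
    by (meson mult_left_mono norm_ge_zero order_trans)
  then show "w \<bullet> n \<le> ?g * norm w * norm n" by (simp only: mult_ac)
qed

section \<open>Surfaces of positive reach\<close>

lemma le_of_mult_self_le:
  fixes x y :: real
  assumes "x * x \<le> x * y" "0 \<le> y"
  shows "x \<le> y"
  using assms mult_le_cancel_left_pos[of x x y] by (cases "0 < x") auto

text \<open>Two scales are kept apart: \<open>r\<close> comes from charts and compactness and is not
  controlled over the class of surfaces, while \<rho> is a bound on the reach shared by both
  surfaces. The estimates exported to the comparison of surfaces involve only \<rho>.\<close>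

locale reach_surface =
  fixes S :: "'a::euclidean_space set" and T :: "'a \<Rightarrow> 'a set" and r \<rho> :: real
  assumes compact_S: "compact S" and r_pos: "0 < r" and rho_pos: "0 < \<rho>"
    and reach_ge: "ereal \<rho> \<le> reach S"
    and tangent: "a \<in> S \<Longrightarrow> tangent_space r S (ball a r) a (T a)"
begin

section \<open>The closest point map within the reach\<close>

lemma subspace_T: "a \<in> S \<Longrightarrow> subspace (T a)"
  using tangent by (simp add: tangent_space_def)

lemma closest_in: "x \<in> S \<Longrightarrow> closest_point S z \<in> S"
  and closest_le: "y \<in> S \<Longrightarrow> dist z (closest_point S z) \<le> dist z y"
  using closest_point_exists[OF compact_imp_closed[OF compact_S]] by blast+

lemma closest_point_unique:
  assumes "x \<in> S" "dist x z < \<rho>" and a: "a \<in> S" "\<forall>y\<in>S. dist z a \<le> dist z y"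
  shows "closest_point S z = a"
proof (rule ccontr)
  assume "closest_point S z \<noteq> a"
  then have "z \<in> medial_axis S"
    using a closest_in[OF \<open>x \<in> S\<close>] closest_le unfolding medial_axis_def by blast
  then have "reach S \<le> ereal (dist x z)"
    unfolding reach_def using \<open>x \<in> S\<close> by (meson INF_lower INF_lower2)
  then show False using reach_ge assms(2) by (metis ereal_less_eq(3) leD order_trans)
qed

lemma closest_point_self_in: "x \<in> S \<Longrightarrow> closest_point S x = x"
  using closest_le[of x x] by simp

text \<open>Closed graph theorem with compact target: by uniqueness, the graph is exactly the set of
  pairs satisfying the distance inequalities, and those are closed conditions.\<close>

lemma continuous_closest_point:
  assumes W: "\<And>z. z \<in> W \<Longrightarrow> \<exists>x\<in>S. dist x z < \<rho>" and "closed W"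
  shows "continuous_on W (closest_point S)"
proof (rule continuous_from_closed_graph[OF compact_S])
  show "closest_point S \<in> W \<rightarrow> S" using W closest_in by blast
  have "(\<lambda>z. (z, closest_point S z)) ` W = (W \<times> S) \<inter> (\<Inter>y\<in>S. {p. dist (fst p) (snd p) \<le> dist (fst p) y})"
    (is "?G = ?R")
  proof
    show "?G \<subseteq> ?R" using W closest_in closest_le by fastforce
    show "?R \<subseteq> ?G"
    proof
      fix p assume p: "p \<in> ?R"
      then obtain x where "x \<in> S" "dist x (fst p) < \<rho>" using W[of "fst p"] by auto
      then have "closest_point S (fst p) = snd p" using p by (intro closest_point_unique) auto
      then show "p \<in> ?G" using p by (auto intro!: image_eqI[of _ _ "fst p"])
    qed
  qed
  moreover have "closed ?R"
    using \<open>closed W\<close> compact_imp_closed[OF compact_S]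
    by (intro closed_Int closed_Times closed_INT ballI closed_Collect_le continuous_intros) auto
  ultimately show "closed ((\<lambda>z. (z, closest_point S z)) ` W)" by simp
qed

text \<open>Pushing \<open>z\<close> away from its closest point \<open>a\<close> does not change the closest point, as long as
  the distance to \<open>S\<close> stays below the reach: a fixed point of \<open>w \<mapsto> z + \<eta> (z - P w) / |z - P w|\<close>,
  where \<open>P\<close> is the closest point map, is a point at distance \<open>\<eta>\<close> beyond \<open>z\<close> on the ray from \<open>P w\<close>.\<close>

lemma closest_point_inner:
  assumes "x \<in> S" "dist x z < \<rho>" "y \<in> S"
  shows "(z - closest_point S z) \<bullet> (y - closest_point S z)
    \<le> norm (z - closest_point S z) * (norm (y - closest_point S z))\<^sup>2 / (2 * \<rho>)"
proof (cases "z \<in> S")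
  case True
  then show ?thesis by (simp add: closest_point_self_in)
next
  case False
  let ?P = "closest_point S"
  define a where "a = ?P z"
  define \<delta> where "\<delta> = norm (z - a)"
  have "a \<in> S" using closest_in \<open>x \<in> S\<close> a_def by blast
  have "0 < \<delta>" using False \<open>a \<in> S\<close> by (auto simp: \<delta>_def)
  have "\<delta> < \<rho>" using closest_le[OF \<open>x \<in> S\<close>, of z] assms(2) by (simp add: \<delta>_def a_def dist_norm norm_minus_commute)
  have step: "2 * t * ((z - a) \<bullet> (y - a)) \<le> \<delta> * (norm (y - a))\<^sup>2" if t: "\<delta> < t" "t < \<rho>" for t
  proof -
    define \<eta> where "\<eta> = t - \<delta>"
    have "0 < \<eta>" using t by (simp add: \<eta>_def)
    have P_ne: "z - ?P w \<noteq> 0" for w using False closest_in[OF \<open>x \<in> S\<close>, of w] by auto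
    \<comment> \<open>Points of this ball are at distance at most \<delta> + \<eta> = t < \<rho>
      from \<open>a\<close>, so the closest point map is continuous on it.\<close>
    have "\<exists>x\<in>S. dist x w < \<rho>" if "w \<in> cball z \<eta>" for w
      using that t \<open>a \<in> S\<close> dist_triangle[of a w z]
      by (intro bexI[of _ a]) (auto simp: \<eta>_def \<delta>_def dist_norm norm_minus_commute)
    then have "continuous_on (cball z \<eta>) ?P" by (rule continuous_closest_point[OF _ closed_cball])
    then have "continuous_on (cball z \<eta>) (\<lambda>w. z + (\<eta> / norm (z - ?P w)) *\<^sub>R (z - ?P w))"
      using P_ne by (intro continuous_intros) auto
    moreover have "(\<lambda>w. z + (\<eta> / norm (z - ?P w)) *\<^sub>R (z - ?P w)) \<in> cball z \<eta> \<rightarrow> cball z \<eta>"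
      using P_ne \<open>0 < \<eta>\<close> by (auto simp: dist_norm)
    ultimately obtain w where "w \<in> cball z \<eta>" and w: "z + (\<eta> / norm (z - ?P w)) *\<^sub>R (z - ?P w) = w"
      by (rule brouwer_ball[OF \<open>0 < \<eta>\<close>])
    define b where "b = ?P w"
    have wz: "w - z = (\<eta> / norm (z - b)) *\<^sub>R (z - b)" using w by (simp add: b_def algebra_simps)
    have "dist z w = \<eta>" using P_ne[of w] \<open>0 < \<eta>\<close>
      by (simp add: dist_norm norm_minus_commute[of z w] wz b_def)
    have "w - b = (1 + \<eta> / norm (z - b)) *\<^sub>R (z - b)" using wz by (simp add: algebra_simps)
    then have "dist w b = \<bar>1 + \<eta> / norm (z - b)\<bar> * norm (z - b)" by (simp add: dist_norm)
    also have "\<dots> = norm (z - b) + \<eta>" using P_ne[of w] \<open>0 < \<eta>\<close> by (simp add: b_def field_simps)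
    finally have wb: "dist w b = norm (z - b) + \<eta>" .
    \<comment> \<open>The point \<open>z\<close> lies on the segment from \<open>b\<close> to
      \<open>w\<close>, so a point of \<open>S\<close> closer to \<open>z\<close> than
      \<open>b\<close> would also be closer to \<open>w\<close>. Hence \<open>b\<close> is the
      closest point of \<open>z\<close>, that is \<open>a\<close>.\<close>
    have "dist z b \<le> dist z y'" if "y' \<in> S" for y'
      using closest_le[OF that, of w] dist_triangle[of w y' z] wb \<open>dist z w = \<eta>\<close>
      by (simp add: b_def dist_norm norm_minus_commute)
    then have "?P z = b"
      using closest_in[OF \<open>x \<in> S\<close>] by (intro closest_point_unique[OF assms(1,2)]) (auto simp: b_def)
    then have "b = a" by (simp add: a_def)
    have "dist w a \<le> dist w y" using closest_le[OF \<open>y \<in> S\<close>, of w] \<open>b = a\<close> by (simp add: b_def)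
    then have "2 * ((w - a) \<bullet> (y - a)) \<le> (norm (y - a))\<^sup>2" by (simp only: dist_le_iff_inner)
    moreover have "w - a = (t / \<delta>) *\<^sub>R (z - a)"
    proof -
      have "1 + \<eta> / norm (z - a) = t / \<delta>" using \<open>0 < \<delta>\<close> by (simp add: \<eta>_def \<delta>_def[symmetric] field_simps)
      then show ?thesis using \<open>w - b = _\<close> \<open>b = a\<close> by simp
    qed
    ultimately have "2 * (t / \<delta> * ((z - a) \<bullet> (y - a))) \<le> (norm (y - a))\<^sup>2"
      by (simp only: inner_scaleR_left)
    then show ?thesis using \<open>0 < \<delta>\<close> by (simp add: field_simps)
  qed
  have "2 * \<rho> * ((z - a) \<bullet> (y - a)) \<le> \<delta> * (norm (y - a))\<^sup>2"
  proof (cases "(z - a) \<bullet> (y - a) \<le> 0")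
    case True
    then have "2 * \<rho> * ((z - a) \<bullet> (y - a)) \<le> 0" using rho_pos by (simp add: mult_nonneg_nonpos)
    also have "0 \<le> \<delta> * (norm (y - a))\<^sup>2" by (simp add: \<delta>_def)
    finally show ?thesis .
  next
    case False
    \<comment> \<open>This is the limit of \<open>step\<close> as t tends to \<rho>.\<close>
    have "\<rho> \<le> \<delta> * (norm (y - a))\<^sup>2 / (2 * ((z - a) \<bullet> (y - a)))"
      using step False by (intro dense_le_bounded[OF \<open>\<delta> < \<rho>\<close>]) (simp add: field_simps)
    then show ?thesis using False by (simp add: field_simps)
  qed
  then show ?thesis using rho_pos by (simp add: a_def[symmetric] \<delta>_def[symmetric] field_simps)
qed

text \<open>Moving from \<open>a\<close> a short distance \<open>t\<close> along \<open>n\<close>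
  gives a point \<open>z\<close> whose closest point is \<open>a\<close>: the tangent estimate
  handles nearby points of \<open>S\<close>, the bound t \<le> r / 2 the others. The inequality for
  closest points then replaces the uncontrolled scale \<open>r\<close> by \<rho>.\<close>

lemma normal_inner:
  assumes "a \<in> S" "n \<in> orthogonal_comp (T a)" "y \<in> S"
  shows "n \<bullet> (y - a) \<le> norm n * (norm (y - a))\<^sup>2 / (2 * \<rho>)"
proof (cases "n = 0")
  case False
  define t where "t = min (r / 2) (\<rho> / 2)"
  have t: "0 < t" "t \<le> r / 2" "t < \<rho>" using r_pos rho_pos by (auto simp: t_def)
  define z where "z = a + (t / norm n) *\<^sub>R n"
  have za: "norm (z - a) = t" using False t by (simp add: z_def)
  have "dist z a \<le> dist z y'" if "y' \<in> S" for y'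
  proof (cases "norm (y' - a) < r")
    case True
    then have "y' \<in> S \<inter> ball a r" using that by (simp add: dist_norm norm_minus_commute)
    then obtain v where "v \<in> T a" and v: "norm (y' - a - v) \<le> (norm (y' - a))\<^sup>2 / r"
      using tangent[OF \<open>a \<in> S\<close>] unfolding tangent_space_def by blast
    have "(z - a) \<bullet> v = 0"
      using orthogonal_comp_inner[OF assms(2) \<open>v \<in> T a\<close>] by (simp add: z_def inner_commute)
    then have "(z - a) \<bullet> (y' - a) = (z - a) \<bullet> (y' - a - v)" by (simp add: inner_diff_right)
    also have "\<dots> \<le> t * ((norm (y' - a))\<^sup>2 / r)"
      using order_trans[OF norm_cauchy_schwarz mult_left_mono[OF v norm_ge_zero]] za by metis
    also have "\<dots> \<le> r / 2 * ((norm (y' - a))\<^sup>2 / r)" using t r_pos by (intro mult_right_mono) auto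
    finally show ?thesis using r_pos by (simp add: dist_le_iff_inner)
  next
    case False
    then show ?thesis using za t dist_triangle[of y' a z] by (simp add: dist_norm norm_minus_commute)
  qed
  moreover have "dist a z < \<rho>" using za t by (simp add: dist_norm norm_minus_commute)
  ultimately have "closest_point S z = a"
    using closest_point_unique[OF \<open>a \<in> S\<close>] \<open>a \<in> S\<close> by blast
  then have "(z - a) \<bullet> (y - a) \<le> t * (norm (y - a))\<^sup>2 / (2 * \<rho>)"
    using closest_point_inner[OF \<open>a \<in> S\<close> \<open>dist a z < \<rho>\<close> \<open>y \<in> S\<close>] za by simp
  then have "t * (n \<bullet> (y - a)) \<le> t * (norm n * (norm (y - a))\<^sup>2 / (2 * \<rho>))"
    using False by (simp add: z_def field_simps)
  then show ?thesis using t(1) by (simp only: mult_le_cancel_left_pos)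
qed simp

text \<open>Add the variational inequalities at the two closest points. Their errors amount to at
  most h / \<rho> times the squared distance of these points, and Cauchy-Schwarz bounds what remains
  by the distance of \<open>p\<close> and \<open>q\<close>.\<close>

lemma closest_point_Lipschitz:
  assumes "x \<in> S" "dist x p \<le> h" "x' \<in> S" "dist x' q \<le> h" "h < \<rho>"
  shows "(\<rho> - h) * dist (closest_point S p) (closest_point S q) \<le> \<rho> * dist p q"
proof -
  let ?a = "closest_point S p" and ?b = "closest_point S q"
  have ab: "?a \<in> S" "?b \<in> S" using closest_in \<open>x \<in> S\<close> by blast+
  have pa: "norm (p - ?a) \<le> h" "norm (q - ?b) \<le> h"
    using closest_le[OF \<open>x \<in> S\<close>, of p] closest_le[OF \<open>x' \<in> S\<close>, of q] assms
    by (simp_all add: dist_norm norm_minus_commute)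
  have half: "n * d\<^sup>2 / (2 * \<rho>) \<le> h * d\<^sup>2 / (2 * \<rho>)" if "n \<le> h" for n d :: real
    using that rho_pos by (intro divide_right_mono mult_right_mono) auto
  define E where "E = h * (norm (?a - ?b))\<^sup>2 / (2 * \<rho>)"
  have "(p - ?a) \<bullet> (?b - ?a) \<le> E"
    using order_trans[OF closest_point_inner[OF \<open>x \<in> S\<close> _ ab(2)] half[OF pa(1)]] assms
    by (simp add: E_def norm_minus_commute)
  moreover have "(q - ?b) \<bullet> (?a - ?b) \<le> E"
    using order_trans[OF closest_point_inner[OF \<open>x' \<in> S\<close> _ ab(1)] half[OF pa(2)]] assms by (simp add: E_def)
  moreover have "(p - q) \<bullet> (?a - ?b) = (norm (?a - ?b))\<^sup>2 - (p - ?a) \<bullet> (?b - ?a) - (q - ?b) \<bullet> (?a - ?b)"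
    by (simp add: power2_norm_eq_inner inner_diff inner_commute)
  moreover have "(p - q) \<bullet> (?a - ?b) \<le> norm (p - q) * norm (?a - ?b)" by (rule norm_cauchy_schwarz)
  ultimately have "(norm (?a - ?b))\<^sup>2 \<le> 2 * E + norm (p - q) * norm (?a - ?b)"
    by linarith
  then have "norm (?a - ?b) * ((\<rho> - h) * norm (?a - ?b)) \<le> norm (?a - ?b) * (\<rho> * norm (p - q))"
    using rho_pos by (simp add: E_def field_simps power2_eq_square)
  then show ?thesis
    using rho_pos by (cases "?a = ?b") (auto simp: dist_norm)
qed

text \<open>Points of \<open>S\<close> at distance about h = \<open>dist a b\<close> from
  \<open>a\<close> are compared with the normals at \<open>a\<close> and at \<open>b\<close>. The
  restriction to \<open>r / 2\<close> guarantees that such points exist in every tangent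
  direction.\<close>

lemma gap_local:
  assumes "a \<in> S" "b \<in> S" "dist a b \<le> r / 2"
  shows "gap_le (T a) (T b) (10 / \<rho> * dist a b)"
proof (cases "a = b")
  case True
  then show ?thesis by (simp add: gap_le_refl)
next
  case False
  define h where "h = dist a b"
  have "0 < h" "h \<le> r / 2" using False assms by (auto simp: h_def)
  \<comment> \<open>The value 29 / 8 is (5 / 2)^2 / 2 for y - b plus 1 / 2 for a - b; the total 19 /
    2 is then rounded up to 10.\<close>
  have "gap_le (T a) (T b) (2 * (29 / 8 * h\<^sup>2 / \<rho> + 9 / 8 * h\<^sup>2 / \<rho>) / h)"
  proof (rule gap_le_from_points[where Y = S and a = a])
    fix w assume w: "w \<in> T a" "norm w = h"
    then obtain y where "y \<in> S" "norm (y - a - w) \<le> h\<^sup>2 / r"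
      using tangent[OF \<open>a \<in> S\<close>] \<open>h \<le> r / 2\<close> r_pos unfolding tangent_space_def by fastforce
    moreover have "h\<^sup>2 / r \<le> h / 2"
      using \<open>h \<le> r / 2\<close> \<open>0 < h\<close> r_pos by (simp add: field_simps power2_eq_square)
    ultimately show "\<exists>y\<in>S. norm (y - a - w) \<le> h / 2" using order_trans by blast
  next
    fix n y assume n: "n \<in> orthogonal_comp (T b)" and "y \<in> S" and ya: "norm (y - a) \<le> 3 / 2 * h"
    have yb: "norm (y - b) \<le> 5 / 2 * h"
      using ya norm_triangle_ineq[of "y - a" "a - b"] by (simp add: h_def dist_norm)
    have "n \<bullet> (y - b) \<le> norm n * (norm (y - b))\<^sup>2 / (2 * \<rho>)" using normal_inner assms n \<open>y \<in> S\<close> by blast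
    also have "\<dots> \<le> norm n * (5 / 2 * h)\<^sup>2 / (2 * \<rho>)"
      using yb rho_pos by (intro divide_right_mono mult_left_mono power_mono) auto
    finally have "n \<bullet> (y - b) \<le> 25 / 8 * h\<^sup>2 / \<rho> * norm n" by (simp add: power2_eq_square field_simps)
    moreover have "- n \<in> orthogonal_comp (T b)" using n by (auto simp: orthogonal_comp_def orthogonal_def)
    then have "(- n) \<bullet> (a - b) \<le> norm n * h\<^sup>2 / (2 * \<rho>)"
      using normal_inner[of b "- n" a] assms by (simp add: h_def dist_norm)
    ultimately show "n \<bullet> (y - a) \<le> 29 / 8 * h\<^sup>2 / \<rho> * norm n"
      by (simp add: inner_diff_right field_simps)
  qed (use normal_inner assms subspace_T \<open>0 < h\<close> rho_pos in auto)
  moreover have "2 * (29 / 8 * h\<^sup>2 / \<rho> + 9 / 8 * h\<^sup>2 / \<rho>) / h \<le> 10 / \<rho> * h"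
    using \<open>0 < h\<close> rho_pos by (simp add: field_simps power2_eq_square)
  ultimately show ?thesis unfolding h_def[symmetric] by (rule gap_le_mono)
qed

text \<open>The points \<open>closest_point S (x + s u)\<close> form a path of length \<open>O(|u|)\<close> on \<open>S\<close>, along which the local
  gap bound (valid only at the scale \<open>r\<close>, but with a constant depending on \<open>\<rho>\<close> alone) is summed.\<close>

lemma near_tangent_vector:
  assumes "x \<in> S" "u \<in> T x" "norm u \<le> \<rho> / 2"
  shows "\<exists>y\<in>S. norm (y - x - u) \<le> 22 * (norm u)\<^sup>2 / \<rho>"
proof -
  define a where "a s = closest_point S (x + s *\<^sub>R u)" for s
  have aS: "a s \<in> S" for s using closest_in assms(1) by (simp add: a_def)
  have "a 0 = x" using closest_point_self_in assms(1) by (simp add: a_def)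
  have near: "dist x (x + s *\<^sub>R u) \<le> \<rho> / 2" if "s \<in> {0..1}" for s
    using that assms(3) mult_mono[of "\<bar>s\<bar>" 1 "norm u" "\<rho> / 2"] by (simp add: dist_norm)
  have lip: "dist (a s) (a t) \<le> 2 * norm u * \<bar>s - t\<bar>" if "s \<in> {0..1}" "t \<in> {0..1}" for s t
  proof -
    have "(\<rho> - \<rho> / 2) * dist (a s) (a t) \<le> \<rho> * dist (x + s *\<^sub>R u) (x + t *\<^sub>R u)"
      unfolding a_def using near that assms(1) rho_pos by (intro closest_point_Lipschitz[of x _ _ x]) auto
    moreover have "dist (x + s *\<^sub>R u) (x + t *\<^sub>R u) = \<bar>s - t\<bar> * norm u"
      by (simp add: dist_norm flip: scaleR_diff_left)
    ultimately show ?thesis using rho_pos by (simp add: mult_ac)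
  qed
  \<comment> \<open>So many subdivisions make each step of the path, of length at most 2 |u| / N,
    short enough for the local gap bound.\<close>
  obtain N :: nat where N: "4 * norm u / r < real N" using reals_Archimedean2 by blast
  have "0 \<le> 4 * norm u / r" using r_pos by simp
  then have "0 < N" using N by linarith
  have "gap_le (T x) (T (a (i / N))) (20 * norm u / \<rho> * (i / N))" if "i \<le> N" for i :: nat
    using that
  proof (induction i)
    case 0
    then show ?case by (simp add: \<open>a 0 = x\<close> gap_le_refl)
  next
    case (Suc i)
    have "\<bar>real i / N - real (Suc i) / N\<bar> = 1 / N" using \<open>0 < N\<close> by (simp add: field_simps)
    then have d: "dist (a (i / N)) (a (Suc i / N)) \<le> 2 * norm u / N"
      using lip[of "i / N" "Suc i / N"] Suc.prems by simp
    also have "\<dots> \<le> r / 2" using N r_pos \<open>0 < N\<close> by (simp add: field_simps)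
    finally have "gap_le (T (a (i / N))) (T (a (Suc i / N))) (10 / \<rho> * dist (a (i / N)) (a (Suc i / N)))"
      using aS by (intro gap_local)
    moreover have "10 / \<rho> * dist (a (i / N)) (a (Suc i / N)) \<le> 10 / \<rho> * (2 * norm u / N)"
      using rho_pos by (intro mult_left_mono[OF d]) simp
    ultimately have "gap_le (T (a (i / N))) (T (a (Suc i / N))) (10 / \<rho> * (2 * norm u / N))"
      by (rule gap_le_mono)
    then have "gap_le (T x) (T (a (Suc i / N))) (20 * norm u / \<rho> * (i / N) + 10 / \<rho> * (2 * norm u / N))"
      using Suc aS subspace_T rho_pos by (intro gap_le_trans[of _ "T (a (i / N))"]) auto
    moreover have "20 * norm u / \<rho> * (i / N) + 10 / \<rho> * (2 * norm u / N) = 20 * norm u / \<rho> * (Suc i / N)"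
      by (simp add: add_divide_distrib algebra_simps)
    ultimately show ?case by simp
  qed
  from this[of N] have gap: "gap_le (T x) (T (a 1)) (20 * norm u / \<rho>)" using \<open>0 < N\<close> by simp
  define v where "v = x + u - a 1"
  have va: "norm (a 1 - x) \<le> 2 * norm u" using lip[of 1 0] \<open>a 0 = x\<close> by (simp add: dist_norm)
  have "v \<bullet> w = 0" if "w \<in> T (a 1)" for w
  proof -
    have "(x + 1 *\<^sub>R u - a 1) \<bullet> w = 0"
      by (rule nearest_point_inner_tangent[OF tangent[OF aS[of 1]] r_pos _ that])
        (use closest_le in \<open>auto simp: a_def\<close>)
    then show ?thesis by (simp add: v_def)
  qed
  then have v: "v \<in> orthogonal_comp (T (a 1))"
    by (auto simp: orthogonal_comp_def orthogonal_def inner_commute)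
  have "u \<bullet> v \<le> 20 * norm u / \<rho> * norm u * norm v" using gap v assms by (auto simp: gap_le_def)
  moreover have "v \<bullet> (x - a 1) \<le> norm v * (norm (x - a 1))\<^sup>2 / (2 * \<rho>)"
    using normal_inner[OF aS v assms(1)] .
  moreover have "norm v * (norm (x - a 1))\<^sup>2 / (2 * \<rho>) \<le> norm v * (2 * norm u)\<^sup>2 / (2 * \<rho>)"
    using va rho_pos by (intro divide_right_mono mult_left_mono power_mono) (auto simp: norm_minus_commute)
  \<comment> \<open>The residual \<open>v\<close> is normal to \<open>S\<close> at
    \<open>a 1\<close>. Of the final constant 22, the pairing with x - a 1 contributes 2 and the
    accumulated gap, paired with \<open>u\<close>, contributes 20.\<close>
  moreover have "(norm v)\<^sup>2 = v \<bullet> (x - a 1) + u \<bullet> v"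
    by (simp add: power2_norm_eq_inner v_def inner_diff inner_add inner_commute)
  ultimately have "norm v * norm v \<le> norm v * (22 * (norm u)\<^sup>2 / \<rho>)"
    using rho_pos by (simp add: power2_eq_square field_simps)
  then have "norm v \<le> 22 * (norm u)\<^sup>2 / \<rho>"
    by (rule le_of_mult_self_le) (use rho_pos in simp)
  moreover have "norm (a 1 - x - u) = norm v"
    unfolding v_def by (subst norm_minus_commute) (simp add: algebra_simps)
  ultimately show ?thesis using aS[of 1] by (intro bexI[of _ "a 1"]) simp_all
qed

end

section \<open>Two surfaces with a common sample\<close>

text \<open>Sample points lie on both surfaces, so the normal inequalities of both are available on
  \<open>X\<close>; that \<open>X\<close> is \<epsilon>-dense in \<open>S1\<close> supplies points
  in every direction of \<open>T1 x\<close>.\<close>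

lemma gap_at_common_point:
  assumes "reach_surface S1 T1 r1 \<rho>" "reach_surface S2 T2 r2 \<rho>" "X \<subseteq> S1 \<inter> S2"
    and dense: "\<And>y. y \<in> S1 \<Longrightarrow> \<exists>x\<in>X. dist y x \<le> \<epsilon>"
    and "x \<in> X" "0 < \<epsilon>" "\<epsilon> \<le> \<rho> / 352"
  shows "gap_le (T1 x) (T2 x) (18 * \<epsilon> / \<rho>)"
proof -
  interpret S1: reach_surface S1 T1 r1 \<rho> by fact
  interpret S2: reach_surface S2 T2 r2 \<rho> by fact
  define h where "h = 4 * \<epsilon>"
  have "x \<in> S1" "x \<in> S2" using assms by auto
  have "gap_le (T1 x) (T2 x) (2 * (9 / 8 * h\<^sup>2 / \<rho> + 9 / 8 * h\<^sup>2 / \<rho>) / h)"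
  proof (rule gap_le_from_points[where Y = X and a = x])
    show "subspace (T1 x)" using S1.subspace_T \<open>x \<in> S1\<close> .
    show "0 < h" using \<open>0 < \<epsilon>\<close> by (simp add: h_def)
    show "0 < \<rho>" by (rule S1.rho_pos)
    show "0 \<le> 9 / 8 * h\<^sup>2 / \<rho>" using S1.rho_pos by simp
  next
    fix w assume w: "w \<in> T1 x" "norm w = h"
    have "norm w \<le> \<rho> / 2" using w(2) assms(7) S1.rho_pos by (simp add: h_def)
    then obtain y where "y \<in> S1" and y: "norm (y - x - w) \<le> 22 * h\<^sup>2 / \<rho>"
      using S1.near_tangent_vector[OF \<open>x \<in> S1\<close> w(1)] w(2) by metis
    \<comment> \<open>Here 22 * 4^2 = 352 makes the surface point within \<epsilon> of x + w; a
      sample point within \<epsilon> of it is then within 2 \<epsilon> = h / 2.\<close>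
    have "22 * h\<^sup>2 / \<rho> = 352 * \<epsilon> * \<epsilon> / \<rho>" by (simp add: h_def power2_eq_square)
    also have "\<dots> \<le> \<rho> * \<epsilon> / \<rho>"
      using assms(6,7) S1.rho_pos by (intro divide_right_mono mult_right_mono) auto
    finally have y': "norm (y - x - w) \<le> \<epsilon>" using y S1.rho_pos by simp
    obtain x' where "x' \<in> X" "dist y x' \<le> \<epsilon>" using dense \<open>y \<in> S1\<close> by blast
    moreover have "norm (x' - x - w) \<le> norm (y - x - w) + dist y x'"
      using norm_triangle_ineq4[of "y - x - w" "y - x'"] by (simp add: dist_norm algebra_simps)
    ultimately have "norm (x' - x - w) \<le> h / 2" using y' by (simp add: h_def)
    then show "\<exists>y\<in>X. norm (y - x - w) \<le> h / 2" using \<open>x' \<in> X\<close> by blast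
  next
    fix m y assume "m \<in> orthogonal_comp (T1 x)" "y \<in> X"
    then show "m \<bullet> (y - x) \<le> norm m * (norm (y - x))\<^sup>2 / (2 * \<rho>)"
      using S1.normal_inner \<open>x \<in> S1\<close> assms(3) by blast
  next
    fix n y assume n: "n \<in> orthogonal_comp (T2 x)" and "y \<in> X" and yx: "norm (y - x) \<le> 3 / 2 * h"
    have "n \<bullet> (y - x) \<le> norm n * (norm (y - x))\<^sup>2 / (2 * \<rho>)"
      using S2.normal_inner \<open>x \<in> S2\<close> assms(3) n \<open>y \<in> X\<close> by blast
    also have "\<dots> \<le> norm n * (3 / 2 * h)\<^sup>2 / (2 * \<rho>)"
      using yx S1.rho_pos by (intro divide_right_mono mult_left_mono power_mono) auto
    finally show "n \<bullet> (y - x) \<le> 9 / 8 * h\<^sup>2 / \<rho> * norm n" by (simp add: power2_eq_square field_simps)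
  qed
  moreover have "2 * (9 / 8 * h\<^sup>2 / \<rho> + 9 / 8 * h\<^sup>2 / \<rho>) / h \<le> 18 * \<epsilon> / \<rho>"
    using \<open>0 < \<epsilon>\<close> S1.rho_pos by (simp add: h_def power2_eq_square)
  ultimately show ?thesis by (rule gap_le_mono)
qed

text \<open>From a sample point \<open>x\<close> near \<open>p\<close>, split p - x into a part
  \<open>u\<close> tangent to \<open>S2\<close> and a normal part \<open>m\<close>, replace
  \<open>u\<close> by its projection \<open>v\<close> to \<open>T1 x\<close>, and go to a point of
  \<open>S1\<close> near x + v. The three errors are 1 / 2, 18 and 22 times \<epsilon>^2 / \<rho>.
  Only the gap from \<open>T2 x\<close> to \<open>T1 x\<close> enters.\<close>

lemma dist_to_surface_quadratic:
  assumes S1: "reach_surface S1 T1 r1 \<rho>" and S2: "reach_surface S2 T2 r2 \<rho>" and X: "X \<subseteq> S1 \<inter> S2"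
    and dense: "\<And>y. y \<in> S2 \<Longrightarrow> \<exists>x\<in>X. dist y x \<le> \<epsilon>"
    and \<epsilon>: "0 < \<epsilon>" "\<epsilon> \<le> \<rho> / 352" and "p \<in> S2"
  shows "\<exists>q\<in>S1. dist q p \<le> 41 * \<epsilon>\<^sup>2 / \<rho>"
proof -
  interpret S1: reach_surface S1 T1 r1 \<rho> by fact
  interpret S2: reach_surface S2 T2 r2 \<rho> by fact
  obtain x where "x \<in> X" and px: "norm (p - x) \<le> \<epsilon>" using dense[OF \<open>p \<in> S2\<close>] by (auto simp: dist_norm)
  have x: "x \<in> S1" "x \<in> S2" using \<open>x \<in> X\<close> X by auto
  obtain u m where u: "u \<in> T2 x" and m: "m \<in> orthogonal_comp (T2 x)"
    and um: "p - x = u + m" "norm u \<le> norm (p - x)"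
    using orthogonal_decomp[OF S2.subspace_T[OF x(2)]] by metis
  have "norm m * norm m = m \<bullet> (p - x)"
    using orthogonal_comp_inner[OF m u]
    by (simp add: um(1) inner_add_right inner_commute flip: power2_eq_square power2_norm_eq_inner)
  also have "\<dots> \<le> norm m * (norm (p - x))\<^sup>2 / (2 * \<rho>)" using S2.normal_inner[OF x(2) m \<open>p \<in> S2\<close>] .
  also have "\<dots> \<le> norm m * \<epsilon>\<^sup>2 / (2 * \<rho>)"
    using px S1.rho_pos by (intro divide_right_mono mult_left_mono power_mono) auto
  finally have "norm m * norm m \<le> norm m * (\<epsilon>\<^sup>2 / (2 * \<rho>))" by simp
  then have m_le: "norm m \<le> \<epsilon>\<^sup>2 / (2 * \<rho>)"
    by (rule le_of_mult_self_le) (use S1.rho_pos in simp)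
  have gap: "gap_le (T2 x) (T1 x) (18 * \<epsilon> / \<rho>)"
    by (rule gap_at_common_point[OF S2 S1 _ dense \<open>x \<in> X\<close> \<epsilon>]) (use X in auto)
  have "0 \<le> 18 * \<epsilon> / \<rho>" using \<epsilon> S1.rho_pos by simp
  then obtain v e where v: "v \<in> T1 x" "u = v + e" "norm v \<le> norm u" "norm e \<le> 18 * \<epsilon> / \<rho> * norm u"
    using gap_leE[OF gap S1.subspace_T[OF x(1)] u] by metis
  have nu: "norm u \<le> \<epsilon>" using um px by simp
  have "norm e \<le> 18 * \<epsilon> / \<rho> * \<epsilon>"
    by (rule order_trans[OF v(4) mult_left_mono[OF nu]]) fact
  then have e: "norm e \<le> 18 * \<epsilon>\<^sup>2 / \<rho>" by (simp add: power2_eq_square)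
  have "norm v \<le> \<rho> / 2" using v(3) nu \<epsilon> S1.rho_pos by simp
  then obtain q where "q \<in> S1" and q: "norm (q - x - v) \<le> 22 * (norm v)\<^sup>2 / \<rho>"
    using S1.near_tangent_vector[OF x(1) v(1)] by blast
  have "22 * (norm v)\<^sup>2 / \<rho> \<le> 22 * \<epsilon>\<^sup>2 / \<rho>"
    using v(3) nu S1.rho_pos by (intro divide_right_mono mult_left_mono power_mono) auto
  then have q': "norm (q - x - v) \<le> 22 * \<epsilon>\<^sup>2 / \<rho>" using q by simp
  have "q - p = (q - x - v) - (e + m)" using um(1) v(2) by (simp add: algebra_simps)
  then have "norm (q - p) \<le> norm (q - x - v) + (norm e + norm m)"
    using norm_triangle_ineq4[of "q - x - v" "e + m"] norm_triangle_ineq[of e m] by (simp only:)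
  also have "\<dots> \<le> 22 * \<epsilon>\<^sup>2 / \<rho> + (18 * \<epsilon>\<^sup>2 / \<rho> + \<epsilon>\<^sup>2 / (2 * \<rho>))"
    using q' e m_le by (intro add_mono)
  also have "\<dots> \<le> 41 * \<epsilon>\<^sup>2 / \<rho>" using S1.rho_pos by (simp add: field_simps)
  finally show ?thesis using \<open>q \<in> S1\<close> by (auto simp: dist_norm)
qed

section \<open>Curve lengths and intrinsic distances under Lipschitz maps\<close>

lemma curve_length_Lipschitz:
  assumes "0 \<le> K" and "\<And>x y. x \<in> S \<Longrightarrow> y \<in> S \<Longrightarrow> dist (f x) (f y) \<le> K * dist x y"
    and "path_image \<gamma> \<subseteq> S"
  shows "curve_length (f \<circ> \<gamma>) \<le> ereal K * curve_length \<gamma>"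
  unfolding curve_length_def[of "f \<circ> \<gamma>"]
proof (intro SUP_least, clarify)
  fix n :: nat and t :: "nat \<Rightarrow> real"
  assume t: "t 0 = 0" "t n = 1" "mono_on {..n} t"
  have S: "\<gamma> (t i) \<in> S" if "i \<le> n" for i
    using mono_onD[OF t(3), of 0 i] mono_onD[OF t(3), of i n] t that assms(3) by (auto simp: path_image_def)
  let ?l = "\<Sum>i<n. dist (\<gamma> (t i)) (\<gamma> (t (Suc i)))"
  have "(\<Sum>i<n. dist ((f \<circ> \<gamma>) (t i)) ((f \<circ> \<gamma>) (t (Suc i)))) \<le> K * ?l"
    unfolding sum_distrib_left using S assms(2) by (intro sum_mono) auto
  then have "ereal (\<Sum>i<n. dist ((f \<circ> \<gamma>) (t i)) ((f \<circ> \<gamma>) (t (Suc i)))) \<le> ereal K * ereal ?l" by simp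
  moreover have "ereal ?l \<le> curve_length \<gamma>"
    unfolding curve_length_def using t by (intro SUP_upper2[of "(n, t)"]) auto
  then have "ereal K * ereal ?l \<le> ereal K * curve_length \<gamma>"
    using \<open>0 \<le> K\<close> by (intro ereal_mult_left_mono) auto
  ultimately show "ereal (\<Sum>i<n. dist ((f \<circ> \<gamma>) (t i)) ((f \<circ> \<gamma>) (t (Suc i)))) \<le> ereal K * curve_length \<gamma>"
    by (rule order_trans)
qed

lemma intrinsic_dist_Lipschitz:
  assumes "0 < K" and lip: "\<And>x y. x \<in> S \<Longrightarrow> y \<in> S \<Longrightarrow> dist (f x) (f y) \<le> K * dist x y"
    and "f ` S \<subseteq> S'" "f a = a" "f b = b"
  shows "intrinsic_dist S' a b \<le> ereal K * intrinsic_dist S a b"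
proof -
  have "continuous_on S f"
    using lip \<open>0 < K\<close> by (intro lipschitz_on_continuous_on[of K]) (auto simp: lipschitz_on_def)
  \<comment> \<open>Dividing by \<open>K\<close> turns the claim into a lower bound for an infimum,
    including the infinite case.\<close>
  have "intrinsic_dist S' a b / ereal K \<le> intrinsic_dist S a b"
    unfolding intrinsic_dist_def[of S]
  proof (intro INF_greatest, clarify)
    fix \<gamma> assume \<gamma>: "path \<gamma>" "path_image \<gamma> \<subseteq> S" "a = pathstart \<gamma>" "b = pathfinish \<gamma>"
    have "path (f \<circ> \<gamma>)"
      using \<open>continuous_on S f\<close> \<gamma> continuous_on_subset path_continuous_image by blast
    then have "intrinsic_dist S' a b \<le> curve_length (f \<circ> \<gamma>)"
      unfolding intrinsic_dist_def using \<gamma> assms(4,5) image_mono[OF \<gamma>(2), of f] assms(3)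
      by (intro INF_lower) (auto simp: path_image_compose pathstart_compose pathfinish_compose)
    also have "\<dots> \<le> ereal K * curve_length \<gamma>"
      using curve_length_Lipschitz[OF _ lip \<gamma>(2)] \<open>0 < K\<close> by simp
    finally show "intrinsic_dist S' (pathstart \<gamma>) (pathfinish \<gamma>) / ereal K \<le> curve_length \<gamma>"
      using \<open>0 < K\<close> \<gamma> by (simp add: ereal_divide_le_pos)
  qed
  then show ?thesis using \<open>0 < K\<close> by (simp add: ereal_divide_le_pos)
qed

lemma intrinsic_dist_nonneg: "0 \<le> intrinsic_dist S a b"
  unfolding intrinsic_dist_def curve_length_def
proof (intro INF_greatest SUP_upper2)
  \<comment> \<open>The trivial partition 0, 1 already witnesses that the supremum is
    nonnegative.\<close>
  show "(1, real) \<in> {(n, t). t 0 = 0 \<and> t n = 1 \<and> mono_on {..n} t}" by (auto intro: mono_onI)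
qed auto

text \<open>The closest point map onto \<open>S1\<close> carries curves on \<open>S2\<close> to
  curves on \<open>S1\<close> and fixes their endpoints. Its Lipschitz constant \<rho> / (\<rho> -
  h) is at most 1 + 2 h / \<rho> because h \<le> \<rho> / 2, and 2 * 41 = 82.\<close>

lemma intrinsic_dist_le_common_sample:
  assumes S1: "reach_surface S1 T1 r1 \<rho>" and S2: "reach_surface S2 T2 r2 \<rho>" and X: "X \<subseteq> S1 \<inter> S2"
    and dense: "\<And>y. y \<in> S2 \<Longrightarrow> \<exists>x\<in>X. dist y x \<le> \<epsilon>"
    and \<epsilon>: "0 < \<epsilon>" "\<epsilon> \<le> \<rho> / 352" and ab: "a \<in> S1" "b \<in> S1"
  shows "intrinsic_dist S1 a b \<le> ereal (1 + 82 / \<rho>\<^sup>2 * \<epsilon>\<^sup>2) * intrinsic_dist S2 a b"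
proof -
  interpret S1: reach_surface S1 T1 r1 \<rho> by fact
  define h where "h = 41 * \<epsilon>\<^sup>2 / \<rho>"
  have rho: "0 < \<rho>" by (rule S1.rho_pos)
  have "82 * \<epsilon>\<^sup>2 \<le> \<rho>\<^sup>2"
  proof -
    have "\<epsilon>\<^sup>2 \<le> (\<rho> / 352)\<^sup>2" using \<epsilon> by (intro power_mono) auto
    also have "\<dots> \<le> \<rho>\<^sup>2 / 82" by (simp add: power_divide)
    finally show ?thesis by simp
  qed
  then have h: "0 \<le> h" "h \<le> \<rho> / 2" using rho by (auto simp: h_def field_simps power2_eq_square)
  then have "h < \<rho>" using rho by simp
  have near: "\<exists>q\<in>S1. dist q p \<le> h" if "p \<in> S2" for p
    unfolding h_def by (rule dist_to_surface_quadratic[OF S1 S2 X _ \<epsilon> that]) (rule dense)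
  let ?K = "1 + 82 / \<rho>\<^sup>2 * \<epsilon>\<^sup>2"
  have K: "?K = 1 + 2 * h / \<rho>" by (simp add: h_def power2_eq_square)
  have "0 < ?K" by (simp add: add_pos_nonneg)
  moreover have "dist (closest_point S1 p) (closest_point S1 q) \<le> ?K * dist p q" if "p \<in> S2" "q \<in> S2" for p q
  proof -
    obtain p' q' where "p' \<in> S1" "dist p' p \<le> h" "q' \<in> S1" "dist q' q \<le> h"
      using near[OF \<open>p \<in> S2\<close>] near[OF \<open>q \<in> S2\<close>] by blast
    then have "(\<rho> - h) * dist (closest_point S1 p) (closest_point S1 q) \<le> \<rho> * dist p q"
      using \<open>h < \<rho>\<close> by (intro S1.closest_point_Lipschitz) auto
    also have "\<dots> \<le> ((\<rho> - h) * ?K) * dist p q"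
    proof (rule mult_right_mono)
      have "0 \<le> h * (\<rho> - 2 * h) / \<rho>" using h rho by simp
      also have "\<dots> = (\<rho> - h) * ?K - \<rho>" using rho unfolding K by (simp add: field_simps)
      finally show "\<rho> \<le> (\<rho> - h) * ?K" by simp
    qed simp
    finally show ?thesis using \<open>h < \<rho>\<close> by (simp add: mult.assoc)
  qed
  moreover have "closest_point S1 ` S2 \<subseteq> S1" using S1.closest_in[OF ab(1)] by blast
  ultimately show ?thesis
    using S1.closest_point_self_in ab by (intro intrinsic_dist_Lipschitz)
qed

section \<open>From coverings and one-sided bounds to the estimate\<close>

lemma eps_covering_dense:
  assumes "eps_covering \<epsilon> X S" "y \<in> S"
  shows "\<exists>x\<in>X. dist y x \<le> \<epsilon>"
proof -
  have "finite X" and le: "(INF x\<in>X. ereal (norm (y - x))) \<le> ereal \<epsilon>"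
    using assms SUP_upper[OF \<open>y \<in> S\<close>] unfolding eps_covering_def by (blast, meson order_trans)
  \<comment> \<open>An infimum over the empty set would be infinite.\<close>
  have "X \<noteq> {}" using le by (auto simp: top_ereal_def)
  let ?m = "Min ((\<lambda>x. norm (y - x)) ` X)"
  have "ereal ?m \<le> (INF x\<in>X. ereal (norm (y - x)))"
    using \<open>finite X\<close> by (intro INF_greatest) simp
  then have "?m \<le> \<epsilon>" using le by (metis ereal_less_eq(3) order_trans)
  moreover have "?m \<in> (\<lambda>x. norm (y - x)) ` X" using \<open>finite X\<close> \<open>X \<noteq> {}\<close> by (intro Min_in) auto
  ultimately show ?thesis by (auto simp: dist_norm)
qed

text \<open>The two inequalities allow only both values finite or both infinite. In the latter case
  the difference evaluates to \<infinity>, and so does the right-hand side because d is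
  positive.\<close>

lemma ereal_abs_diff_le:
  fixes a b :: ereal
  assumes "a \<le> ereal (1 + c) * b" "b \<le> ereal (1 + c) * a" "0 \<le> a" "0 \<le> b" "0 < c" "c \<le> d"
  shows "\<bar>a - b\<bar> \<le> ereal d * min a b"
proof (cases a b rule: ereal2_cases)
  case (real_real x y)
  have "c * min x y \<le> d * min x y" using assms real_real by (intro mult_right_mono) auto
  moreover have "\<bar>x - y\<bar> \<le> c * min x y" using assms real_real by (auto simp: min_def algebra_simps abs_le_iff)
  ultimately show ?thesis using real_real by (auto simp: min_def split: if_splits)
qed (use assms in auto)

theorem theorem3p3:
  fixes M :: "'a::euclidean_space set" and k :: nat
  assumes "compact M" and "connected M" and "C2_submanifold k M"
  shows "\<exists>C::real. C > 0 \<and>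
    (\<forall>\<epsilon>::real. 0 < \<epsilon> \<and> \<epsilon> \<le> 1 / C \<longrightarrow>
      (\<forall>(n::nat) (x :: nat \<Rightarrow> 'a) X Mh.
         X = x ` {1..n} \<and> eps_covering \<epsilon> X M \<and>
         Mh \<in> surface_class k X \<epsilon> \<and> reach Mh \<ge> rho_max k X \<epsilon> / 2 \<longrightarrow>
         (\<forall>y \<in> M \<inter> Mh. \<forall>y' \<in> M \<inter> Mh.
            \<bar>intrinsic_dist M y y' - intrinsic_dist Mh y y'\<bar>
              \<le> ereal (C * \<epsilon>\<^sup>2) * min (intrinsic_dist M y y') (intrinsic_dist Mh y y')) \<and>
         (let d_hat = (\<lambda>i j. intrinsic_dist Mh (x i) (x j)) in
            \<forall>i \<in> {1..n}. \<forall>j \<in> {1..n}.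
              \<bar>intrinsic_dist M (x i) (x j) - d_hat i j\<bar>
                \<le> ereal (C * \<epsilon>\<^sup>2) * min (intrinsic_dist M (x i) (x j)) (d_hat i j))))"
proof -
  obtain r T where "0 < r" and T: "\<And>a. a \<in> M \<Longrightarrow> tangent_space r M (ball a r) a (T a)"
    using ex_tangent_spaces[OF assms(1,3)] by metis
  \<comment> \<open>The reach of \<open>M\<close> is at least r / 2 = 2 \<rho>. The spare factor 2
    is spent on \<open>Mh\<close>, whose reach is only known to be at least half the
    supremum.\<close>
  define \<rho> where "\<rho> = r / 4"
  have "0 < \<rho>" using \<open>0 < r\<close> by (simp add: \<rho>_def)
  have reach_M: "ereal (2 * \<rho>) \<le> reach M"
    using reach_ge_half[OF \<open>0 < r\<close> T] by (simp add: \<rho>_def)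
  then have "ereal \<rho> \<le> reach M"
    by (rule order_trans[rotated]) (use \<open>0 < \<rho>\<close> in simp)
  then have M: "reach_surface M T r \<rho>"
    using assms(1) \<open>0 < r\<close> \<open>0 < \<rho>\<close> T by unfold_locales
  \<comment> \<open>The first summand turns \<epsilon> \<le> 1 / C into \<epsilon> \<le> \<rho> /
    352, the second is the distortion constant.\<close>
  define C where "C = 352 / \<rho> + 82 / \<rho>\<^sup>2"
  have "0 < C" using \<open>0 < \<rho>\<close> by (simp add: C_def add_pos_pos)
  have main: "\<bar>intrinsic_dist M y y' - intrinsic_dist Mh y y'\<bar>
      \<le> ereal (C * \<epsilon>\<^sup>2) * min (intrinsic_dist M y y') (intrinsic_dist Mh y y')"
    if \<epsilon>: "0 < \<epsilon>" "\<epsilon> \<le> 1 / C" and X: "eps_covering \<epsilon> X M" and Mh: "Mh \<in> surface_class k X \<epsilon>"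
      and reach: "reach Mh \<ge> rho_max k X \<epsilon> / 2" and y: "y \<in> M \<inter> Mh" "y' \<in> M \<inter> Mh"
    for \<epsilon> X Mh y y'
  proof -
    have Mh': "compact Mh" "C2_submanifold k Mh" "X \<subseteq> Mh" "eps_covering \<epsilon> X Mh"
      using Mh by (auto simp: surface_class_def)
    have XM: "X \<subseteq> M" using X by (simp add: eps_covering_def)
    \<comment> \<open>\<open>M\<close> itself competes in the supremum, which transfers its reach
      bound to \<open>Mh\<close>.\<close>
    have "M \<in> surface_class k X \<epsilon>" using assms X XM by (simp add: surface_class_def)
    then have "reach M \<le> rho_max k X \<epsilon>" unfolding rho_max_def by (rule SUP_upper)
    then have "ereal (2 * \<rho>) / 2 \<le> rho_max k X \<epsilon> / 2"
      using reach_M by (intro ereal_divide_right_mono) auto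
    then have reach_Mh: "ereal \<rho> \<le> reach Mh" using reach by (auto intro: order_trans)
    obtain rh Th where "0 < rh" and Th: "\<And>a. a \<in> Mh \<Longrightarrow> tangent_space rh Mh (ball a rh) a (Th a)"
      using ex_tangent_spaces[OF Mh'(1,2)] by metis
    then have Mh: "reach_surface Mh Th rh \<rho>"
      using Mh'(1) \<open>0 < \<rho>\<close> reach_Mh by unfold_locales
    have "352 / \<rho> \<le> C" using \<open>0 < \<rho>\<close> by (simp add: C_def)
    then have "1 / C \<le> 1 / (352 / \<rho>)" using \<open>0 < \<rho>\<close> by (intro divide_left_mono) (auto simp: \<open>0 < C\<close>)
    then have \<epsilon>': "\<epsilon> \<le> \<rho> / 352" using \<epsilon> by simp
    have "intrinsic_dist M y y' \<le> ereal (1 + 82 / \<rho>\<^sup>2 * \<epsilon>\<^sup>2) * intrinsic_dist Mh y y'"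
      using y XM Mh'(3) eps_covering_dense[OF Mh'(4)]
      by (intro intrinsic_dist_le_common_sample[OF M Mh _ _ \<epsilon>(1) \<epsilon>', of X]) auto
    moreover have "intrinsic_dist Mh y y' \<le> ereal (1 + 82 / \<rho>\<^sup>2 * \<epsilon>\<^sup>2) * intrinsic_dist M y y'"
      using y XM Mh'(3) eps_covering_dense[OF X]
      by (intro intrinsic_dist_le_common_sample[OF Mh M _ _ \<epsilon>(1) \<epsilon>', of X]) auto
    moreover have "82 / \<rho>\<^sup>2 * \<epsilon>\<^sup>2 \<le> C * \<epsilon>\<^sup>2"
      using \<open>0 < \<rho>\<close> by (intro mult_right_mono) (auto simp: C_def)
    ultimately show ?thesis
      using \<epsilon>(1) \<open>0 < \<rho>\<close> by (intro ereal_abs_diff_le intrinsic_dist_nonneg) auto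
  qed
  show ?thesis
    unfolding Let_def
  proof (intro exI[of _ C] conjI allI impI ballI \<open>0 < C\<close>)
    fix \<epsilon> n and x :: "nat \<Rightarrow> 'a" and X Mh i j
    assume \<epsilon>: "0 < \<epsilon> \<and> \<epsilon> \<le> 1 / C"
      and *: "X = x ` {1..n} \<and> eps_covering \<epsilon> X M \<and>
         Mh \<in> surface_class k X \<epsilon> \<and> reach Mh \<ge> rho_max k X \<epsilon> / 2"
      and "i \<in> {1..n}" "j \<in> {1..n}"
    then have "x i \<in> M \<inter> Mh" "x j \<in> M \<inter> Mh"
      by (auto simp: eps_covering_def surface_class_def)
    then show "\<bar>intrinsic_dist M (x i) (x j) - intrinsic_dist Mh (x i) (x j)\<bar>
        \<le> ereal (C * \<epsilon>\<^sup>2) * min (intrinsic_dist M (x i) (x j)) (intrinsic_dist Mh (x i) (x j))"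
      using \<epsilon> * by (intro main) auto
  next
    fix \<epsilon> n and x :: "nat \<Rightarrow> 'a" and X Mh y y'
    assume "0 < \<epsilon> \<and> \<epsilon> \<le> 1 / C"
      and "X = x ` {1..n} \<and> eps_covering \<epsilon> X M \<and>
         Mh \<in> surface_class k X \<epsilon> \<and> reach Mh \<ge> rho_max k X \<epsilon> / 2"
      and "y \<in> M \<inter> Mh" "y' \<in> M \<inter> Mh"
    then show "\<bar>intrinsic_dist M y y' - intrinsic_dist Mh y y'\<bar>
        \<le> ereal (C * \<epsilon>\<^sup>2) * min (intrinsic_dist M y y') (intrinsic_dist Mh y y')"
      by (elim conjE) (rule main)
  qed
qed

end
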